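(* Let $M,N\ge2$ be integers and $0<p_0<1$ with $L_{p_0}>0$. The iterated function system on $[0,1)^2$ generated by the two-point maps $f^{(2)}_i$, $0\le i\le M$, with probabilities $p_i$, admits an absolutely continuous stationary probability measure $m^{(2)}$. Furthermore, $m^{(2)}$ has full topological support.
   Context: The maps $f_i:[0,1)\to[0,1)$ are $f_0(x)=Nx\pmod 1$ and $f_i(x)=(x+i-1)/M$ for $1\le i\le M$. The two-point maps are $f^{(2)}_i(x,y)=(f_i(x),f_i(y))$ on $[0,1)^2$. The probabilities are $p_0$ and $p_i=(1-p_0)/M$ for $1\le i\le M$. A measure $m$ on $[0,1)^2$ is stationary if $m=\sum_{i=0}^Mp_i\,(f^{(2)}_i)_*m$, where $(g)_*m(A)=m(g^{-1}(A))$. The Lyapunov exponent is $L_{p_0}=p_0\ln N-(1-p_0)\ln M$. Absolute continuity is with respect to two-dimensional Lebesgue measure. Full topological support means that every nonempty (relatively) open subset of $[0,1)^2$ has positive measure. *)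

theory Defs
  imports "HOL-Probability.Probability"
begin

definition one_point_map :: "nat \<Rightarrow> nat \<Rightarrow> nat \<Rightarrow> real \<Rightarrow> real" where
  "one_point_map N M i x =
     (if i = 0 then frac (real N * x) else (x + real i - 1) / real M)"

definition two_point_map :: "nat \<Rightarrow> nat \<Rightarrow> nat \<Rightarrow> real \<times> real \<Rightarrow> real \<times> real" where
  "two_point_map N M i z = (one_point_map N M i (fst z), one_point_map N M i (snd z))"

definition map_prob :: "nat \<Rightarrow> real \<Rightarrow> nat \<Rightarrow> real" where
  "map_prob M p0 i = (if i = 0 then p0 else (1 - p0) / real M)"

definition lyapunov_exponent :: "nat \<Rightarrow> nat \<Rightarrow> real \<Rightarrow> real" where
  "lyapunov_exponent N M p0 = p0 * ln (real N) - (1 - p0) * ln (real M)"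

definition unit_square :: "(real \<times> real) set" where
  "unit_square = {0..<1} \<times> {0..<1}"

(* Two-dimensional Lebesgue measure on the Borel sets of the square. *)
definition lebesgue_square :: "(real \<times> real) measure" where
  "lebesgue_square = restrict_space lborel unit_square"

definition stationary :: "nat \<Rightarrow> nat \<Rightarrow> real \<Rightarrow> (real \<times> real) measure \<Rightarrow> bool" where
  "stationary N M p0 m \<longleftrightarrow>
     (\<forall>A \<in> sets m. emeasure m A =
        (\<Sum>i = 0..M. ennreal (map_prob M p0 i) * emeasure (distr m m (two_point_map N M i)) A))"

definition full_support :: "(real \<times> real) measure \<Rightarrow> bool" where
  "full_support m \<longleftrightarrow>
     (\<forall>U. openin (top_of_set unit_square) U \<and> U \<noteq> {} \<longrightarrow> emeasure m U > 0)"

lemma space_lebesgue_square: "space lebesgue_square = unit_square"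
  by (simp add: lebesgue_square_def space_restrict_space)

lemma one_point_map_in_unit_interval:
  assumes "x \<in> {0..<1}" "i \<le> M"
  shows "one_point_map N M i x \<in> {0..<1}"
proof (cases "i = 0")
  case False
  then have "real i \<ge> 1" "real i \<le> real M" "real M > 0" using assms by auto
  then show ?thesis using assms False by (auto simp: one_point_map_def field_simps)
qed (auto simp: one_point_map_def frac_lt_1)

(* Hence distr in stationary is the genuine push-forward whenever sets m = sets lebesgue_square. *)
lemma measurable_two_point_map:
  assumes "i \<le> M"
  shows "two_point_map N M i \<in> measurable lebesgue_square lebesgue_square"
proof -
  have [measurable]: "one_point_map N M i \<in> borel_measurable borel"
    unfolding one_point_map_def frac_def by measurable
  have "two_point_map N M i \<in> borel_measurable borel"
    unfolding two_point_map_def borel_prod[symmetric] by measurable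
  then have "two_point_map N M i \<in> measurable lborel lborel"
    by simp
  moreover have "two_point_map N M i z \<in> unit_square" if "z \<in> unit_square" for z
    using that one_point_map_in_unit_interval[OF _ assms]
    unfolding two_point_map_def unit_square_def mem_Times_iff by simp
  ultimately show ?thesis
    unfolding lebesgue_square_def
    by (intro measurable_restrict_space3) auto
qed

end

theory Submission
  imports Defs
begin

text \<open>
  The stationary measure is the limit of the laws \<open>m\<^sub>n\<close> of the two-point motion started from Lebesgue
  measure \<open>m\<^sub>0\<close> on the square: \<open>m\<^sub>n\<^sub>+\<^sub>1 = (\<Sum>i. p\<^sub>i (f\<^sub>i)\<^sub>* m\<^sub>n)\<close>. Two things have to be shown: the sequence converges,
  and no mass escapes to a Lebesgue null set, where the diagonal is the main threat, being attracting under the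
  contractions.

  \<^emph>\<open>No concentration.\<close> Say that \<open>m\<close> has translation defect at most \<open>d\<close> at scale \<open>r\<close> if
  \<open>m A \<le> m (A - t) + d\<close> for all Borel sets \<open>A\<close> and all shifts \<open>t\<close> of size at most \<open>r\<close>. A contraction \<open>f\<^sub>i\<close>
  turns the defect at scale \<open>M r\<close> into a defect at scale \<open>r\<close>. The expanding map \<open>f\<^sub>0\<close> turns the defect at scale
  \<open>r / N\<close> into one at scale \<open>r\<close>, up to the mass of the points that the shift carries out of the square.
  That mass is at most \<open>2 r\<close> because both marginals of every \<open>m\<^sub>n\<close> are Lebesgue measure, which is stationary for
  the one-point maps. So the defects satisfy
  \<open>d\<^sub>n\<^sub>+\<^sub>1(r) \<le> p\<^sub>0 d\<^sub>n(r / N) + (1 - p\<^sub>0) d\<^sub>n(M r) + 2 r\<close>.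
  The function \<open>s \<mapsto> p\<^sub>0 N\<^sup>-\<^sup>s + (1 - p\<^sub>0) M\<^sup>s\<close> has the value \<open>1\<close> and the derivative \<open>-L < 0\<close> at \<open>0\<close>, where \<open>L\<close> is
  the Lyapunov exponent, so it is less than \<open>1\<close> for some small \<open>s > 0\<close>, and induction gives \<open>d\<^sub>n(r) \<le> C r\<^sup>s\<close> with \<open>C\<close> independent of \<open>n\<close>
  (\<open>two_point_law_translation_defect\<close>). Averaging the defining inequality over the shifts in \<open>[0,r]\<^sup>2\<close> yields
  \<open>m\<^sub>n A \<le> |A| / r\<^sup>2 + C r\<^sup>s\<close>, which is absolute continuity uniformly in \<open>n\<close>.

  \<^emph>\<open>Convergence.\<close> For fixed \<open>n\<close>, \<open>(A, B) \<mapsto> m\<^sub>n (A \<times> B)\<close> is a symmetric bilinear form in the indicators of \<open>A\<close>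
  and \<open>B\<close>. By Jensen's inequality its quadratic form increases with \<open>n\<close>
  (\<open>two_point_law_quadratic_form_mono\<close>), and so by polarization \<open>m\<^sub>n (A \<times> B)\<close> converges for all rectangles. Uniform
  absolute continuity extends this to all Borel sets and makes the limit a measure
  (\<open>uniformly_absolutely_continuous_limit\<close>). The limit is stationary and inherits the bounds.

  \<^emph>\<open>Full support.\<close> Let \<open>V\<close> be a small box of side \<open>1 / q\<close> inside the open set. The preimage of \<open>V\<close> under \<open>f\<^sub>0\<^sup>n\<close> is
  periodic with period \<open>N\<^sup>-\<^sup>n\<close>, and \<open>q\<^sup>2\<close> of its translates, by vectors with entries of size at most \<open>N\<^sup>-\<^sup>n\<close>,
  cover the plane. As the translation defect at that scale tends to \<open>0\<close>, the preimage has positive mass for large \<open>n\<close>,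
  and \<open>m V \<ge> p\<^sub>0\<^sup>n m (f\<^sub>0\<^sup>-\<^sup>n V)\<close> by stationarity (\<open>translation_regular_box_positive\<close>).
\<close>

section \<open>Lebesgue measure is stationary for the one-point maps\<close>

lemma borel_measurable_one_point_map [measurable]: "one_point_map N M i \<in> borel_measurable borel"
  unfolding one_point_map_def frac_def by measurable

lemma borel_measurable_two_point_map [measurable]: "two_point_map N M i \<in> borel_measurable borel"
  unfolding two_point_map_def borel_prod[symmetric] by measurable

lemma two_point_map_vimage_Times:
  "two_point_map N M i -` (A \<times> B) = (one_point_map N M i -` A) \<times> (one_point_map N M i -` B)"
  by (auto simp: two_point_map_def)

definition uniform_interval :: "real measure" where
  "uniform_interval = density lborel (indicator {0..<1})"

definition uniform_square :: "(real \<times> real) measure" where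
  "uniform_square = density lborel (indicator unit_square)"

lemma sets_unit_square [measurable]: "unit_square \<in> sets borel"
  unfolding unit_square_def borel_prod[symmetric] by measurable

lemma sets_uniform [simp, measurable_cong]:
  "sets uniform_interval = sets borel" "sets uniform_square = sets borel"
  by (simp_all add: uniform_interval_def uniform_square_def)

lemma emeasure_uniform_interval:
  assumes "A \<in> sets borel"
  shows "emeasure uniform_interval A = emeasure lborel (A \<inter> {0..<1})"
  using assms unfolding uniform_interval_def
  by (subst emeasure_density) (auto simp: Int_commute simp flip: nn_integral_indicator
      intro!: nn_integral_cong split: split_indicator)

lemma emeasure_uniform_square:
  assumes "A \<in> sets borel"
  shows "emeasure uniform_square A = emeasure lborel (A \<inter> unit_square)"
  using assms unfolding uniform_square_def
  by (subst emeasure_density) (auto simp: Int_commute simp flip: nn_integral_indicator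
      intro!: nn_integral_cong split: split_indicator)

lemma emeasure_uniform_square_Times:
  assumes "A \<in> sets borel" "B \<in> sets borel"
  shows "emeasure uniform_square (A \<times> B) = emeasure uniform_interval A * emeasure uniform_interval B"
proof -
  have "A \<times> B \<in> sets borel" using assms by (rule borel_Times)
  then have "emeasure uniform_square (A \<times> B) = emeasure lborel ((A \<times> B) \<inter> unit_square)"
    by (rule emeasure_uniform_square)
  also have "(A \<times> B) \<inter> unit_square = (A \<inter> {0..<1}) \<times> (B \<inter> {0..<1})"
    by (auto simp: unit_square_def)
  also have "emeasure lborel \<dots> = emeasure lborel (A \<inter> {0..<1}) * emeasure lborel (B \<inter> {0..<1})"
    using assms by (subst lborel_prod[symmetric], subst lborel.emeasure_pair_measure_Times) auto
  finally show ?thesis using assms by (simp add: emeasure_uniform_interval)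
qed

lemma prob_space_uniform_square: "prob_space uniform_square"
proof (rule prob_spaceI)
  have "emeasure uniform_square (UNIV \<times> UNIV) = 1"
    by (simp only: emeasure_uniform_square_Times space_borel[symmetric] sets.top)
      (simp add: emeasure_uniform_interval)
  then show "emeasure uniform_square (space uniform_square) = 1"
    by (simp add: uniform_square_def)
qed

lemma measure_uniform_square_Times:
  assumes "A \<in> sets borel" "B \<in> sets borel"
  shows "measure uniform_square (A \<times> B) = measure uniform_interval A * measure uniform_interval B"
  using assms by (simp add: measure_def emeasure_uniform_square_Times enn2real_mult)

lemma emeasure_lborel_vimage_affine:
  fixes a b :: real
  assumes "a \<noteq> 0" "A \<in> sets borel"
  shows "emeasure lborel A = ennreal \<bar>a\<bar> * emeasure lborel ((\<lambda>x. b + a * x) -` A)"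
proof -
  have "emeasure lborel A = emeasure (density (distr lborel borel (\<lambda>x. b + a * x)) (\<lambda>_. ennreal \<bar>a\<bar>)) A"
    by (subst lborel_real_affine[OF assms(1), of b]) simp
  also have "\<dots> = ennreal \<bar>a\<bar> * emeasure lborel ((\<lambda>x. b + a * x) -` A)"
    using assms by (subst emeasure_density_const) (auto simp: emeasure_distr)
  finally show ?thesis .
qed

lemma measure_lborel_vimage_affine:
  fixes a b :: real
  assumes "a \<noteq> 0" "A \<in> sets borel"
  shows "measure lborel A = \<bar>a\<bar> * measure lborel ((\<lambda>x. b + a * x) -` A)"
  using emeasure_lborel_vimage_affine[OF assms, of b] by (simp add: measure_def enn2real_mult)

lemma measure_uniform_interval:
  assumes "A \<in> sets borel"
  shows "measure uniform_interval A = measure lborel (A \<inter> {0..<1})"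
  using assms by (simp add: measure_def emeasure_uniform_interval)

lemma disjoint_family_grid_intervals:
  assumes "K > 0"
  shows "disjoint_family_on (\<lambda>k. {real k / real K..<(real k + 1) / real K}) {..<K}"
proof -
  have "j = k" if "x \<in> {real k / real K..<(real k + 1) / real K}"
    "x \<in> {real j / real K..<(real j + 1) / real K}" for x j k
  proof -
    have "real k < real j + 1" "real j < real k + 1" using that assms
      by (auto simp: field_simps)
    then show ?thesis by linarith
  qed
  then show ?thesis unfolding disjoint_family_on_def by blast
qed

lemma grid_intervals_cover:
  assumes "K > 0"
  shows "(\<Union>k<K. {real k / real K..<(real k + 1) / real K}) = {0..<1}"
proof (intro equalityI subsetI)
  fix x :: real assume x: "x \<in> {0..<1}"
  define k where "k = nat \<lfloor>real K * x\<rfloor>"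
  have k: "real k \<le> real K * x" "real K * x < real k + 1"
    using x by (auto simp: k_def)
  have "real K * x < real K" using x assms by simp
  then have "k < K" using k by linarith
  then show "x \<in> (\<Union>k<K. {real k / real K..<(real k + 1) / real K})"
    using k assms by (auto simp: field_simps intro!: bexI[of _ k])
next
  fix x :: real assume "x \<in> (\<Union>k<K. {real k / real K..<(real k + 1) / real K})"
  then obtain k where k: "k < K" "real k / real K \<le> x" "x < (real k + 1) / real K" by auto
  have "(real k + 1) / real K \<le> 1" using k(1) by simp
  moreover have "0 \<le> real k / real K" by simp
  ultimately show "x \<in> {0..<1}" using k(2,3) unfolding atLeastLessThan_iff by linarith
qed

lemma measure_uniform_interval_grid:
  assumes "K > 0" "A \<in> sets borel"
  shows "measure uniform_interval A =
    (\<Sum>k<K. measure lborel (A \<inter> {real k / real K..<(real k + 1) / real K}))"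
proof -
  have "measure uniform_interval A =
      measure lborel (\<Union>k<K. A \<inter> {real k / real K..<(real k + 1) / real K})"
    using assms by (simp add: measure_uniform_interval grid_intervals_cover flip: Int_UN_distrib)
  also have "\<dots> = (\<Sum>k<K. measure lborel (A \<inter> {real k / real K..<(real k + 1) / real K}))"
  proof (rule measure_finite_Union)
    show "disjoint_family_on (\<lambda>k. A \<inter> {real k / real K..<(real k + 1) / real K}) {..<K}"
      using disjoint_family_grid_intervals[OF assms(1)] unfolding disjoint_family_on_def by blast
    fix k
    have "emeasure lborel (A \<inter> {real k / real K..<(real k + 1) / real K})
      \<le> emeasure lborel {real k / real K..<(real k + 1) / real K}"
      by (intro emeasure_mono) auto
    also have "\<dots> < \<infinity>" by (simp add: emeasure_lborel_Ico assms(1) divide_right_mono)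
    finally show "emeasure lborel (A \<inter> {real k / real K..<(real k + 1) / real K}) \<noteq> \<infinity>" by simp
  qed (use assms in auto)
  finally show ?thesis .
qed

text \<open>Each of the \<open>N\<close> branches of \<open>x \<mapsto> N x\<close> mod \<open>1\<close> maps its interval affinely onto \<open>[0,1)\<close> and so carries
  the share \<open>1 / N\<close> of the mass of \<open>A\<close>.\<close>

lemma uniform_interval_expand:
  assumes "N > 0" "A \<in> sets borel"
  shows "measure uniform_interval (one_point_map N M 0 -` A) = measure uniform_interval A"
proof -
  have piece: "measure lborel (one_point_map N M 0 -` A \<inter> {real k / real N..<(real k + 1) / real N})
      = measure uniform_interval A / real N" if "k < N" for k
  proof -
    have "one_point_map N M 0 -` A \<inter> {real k / real N..<(real k + 1) / real N}
      = (\<lambda>x. - real k + real N * x) -` (A \<inter> {0..<1})"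
    proof (intro set_eqI)
      fix x
      show "x \<in> one_point_map N M 0 -` A \<inter> {real k / real N..<(real k + 1) / real N} \<longleftrightarrow>
          x \<in> (\<lambda>x. - real k + real N * x) -` (A \<inter> {0..<1})"
      proof (cases "real k \<le> real N * x \<and> real N * x < real k + 1")
        case True
        then have "\<lfloor>real N * x\<rfloor> = int k" by linarith
        then show ?thesis using True assms
          by (auto simp: one_point_map_def frac_def field_simps)
      next
        case False
        then show ?thesis using assms by (auto simp: field_simps)
      qed
    qed
    then show ?thesis
      using measure_lborel_vimage_affine[of "real N" "A \<inter> {0..<1}" "- real k"] assms
      by (simp add: measure_uniform_interval)
  qed
  have "one_point_map N M 0 -` A \<in> sets borel"
    using measurable_sets_borel[OF borel_measurable_one_point_map assms(2)] by simp
  then show ?thesis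
    using assms by (simp add: measure_uniform_interval_grid[of N "_ -` A"] piece)
qed

text \<open>The images of the contractions tile \<open>[0,1)\<close>.\<close>

lemma uniform_interval_contract:
  assumes "M > 0" "A \<in> sets borel"
  shows "(\<Sum>i=1..M. measure uniform_interval (one_point_map N M i -` A)) = real M * measure uniform_interval A"
proof -
  have piece: "measure lborel (A \<inter> {real k / real M..<(real k + 1) / real M})
      = measure uniform_interval (one_point_map N M (Suc k) -` A) / real M" if "k < M" for k
  proof -
    have eq: "one_point_map N M (Suc k) = (\<lambda>x. real k / real M + 1 / real M * x)"
      by (auto simp: one_point_map_def add_divide_distrib)
    have "measure lborel (A \<inter> {real k / real M..<(real k + 1) / real M})
      = 1 / real M * measure lborel (one_point_map N M (Suc k) -` (A \<inter> {real k / real M..<(real k + 1) / real M}))"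
      unfolding eq using assms by (subst measure_lborel_vimage_affine[of "1 / real M" _ "real k / real M"]) auto
    also have "one_point_map N M (Suc k) -` (A \<inter> {real k / real M..<(real k + 1) / real M})
        = one_point_map N M (Suc k) -` A \<inter> {0..<1}"
      using assms by (auto simp: one_point_map_def field_simps)
    finally show ?thesis
      using measurable_sets_borel[OF borel_measurable_one_point_map assms(2), of N M "Suc k"]
      by (simp add: measure_uniform_interval)
  qed
  have "(\<Sum>i=1..M. measure uniform_interval (one_point_map N M i -` A))
    = (\<Sum>k<M. measure uniform_interval (one_point_map N M (Suc k) -` A))"
    by (simp add: sum.atLeast1_atMost_eq)
  also have "\<dots> = real M * measure uniform_interval A"
    using assms by (simp add: measure_uniform_interval_grid[of M] piece sum_distrib_left)
  finally show ?thesis .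
qed

section \<open>Self-couplings of Lebesgue measure and their translation defect\<close>

text \<open>The two-point laws are kept as measures on the Borel sets of the whole plane; the condition on the
  marginals forces them to live on the unit square. So translations act without any boundary case
  distinctions.\<close>

definition self_coupling :: "(real \<times> real) measure \<Rightarrow> bool" where
  "self_coupling m \<longleftrightarrow> prob_space m \<and> sets m = sets borel \<and>
     (\<forall>A\<in>sets borel. measure m (A \<times> UNIV) = measure uniform_interval A \<and>
                     measure m (UNIV \<times> A) = measure uniform_interval A)"

text \<open>For a probability measure with density \<open>h\<close>, the least such \<open>d\<close> is half of the \<open>L\<^sup>1\<close> modulus of continuity
  of \<open>h\<close> at scale \<open>r\<close> in the maximum norm, \<open>h\<close> being extended by \<open>0\<close> outside the square.\<close>

definition translation_defect_le :: "(real \<times> real) measure \<Rightarrow> real \<Rightarrow> real \<Rightarrow> bool" where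
  "translation_defect_le m r d \<longleftrightarrow>
     (\<forall>A\<in>sets borel. \<forall>t. \<bar>fst t\<bar> \<le> r \<longrightarrow> \<bar>snd t\<bar> \<le> r \<longrightarrow> measure m A \<le> measure m ((\<lambda>z. z + t) -` A) + d)"

lemma translation_defect_leD:
  assumes "translation_defect_le m r d" "A \<in> sets borel" "\<bar>fst t\<bar> \<le> r" "\<bar>snd t\<bar> \<le> r"
  shows "measure m A \<le> measure m ((\<lambda>z. z + t) -` A) + d"
  using assms unfolding translation_defect_le_def by blast

lemma vimage_translation_in_borel:
  fixes t :: "real \<times> real"
  assumes "A \<in> sets borel"
  shows "(\<lambda>z. z + t) -` A \<in> sets borel"
  using measurable_sets_borel[of "\<lambda>z. z + t" borel A] assms by simp

lemma vimage_two_point_map_in_borel: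
  assumes "A \<in> sets borel"
  shows "two_point_map N M i -` A \<in> sets borel"
  using measurable_sets_borel[OF borel_measurable_two_point_map assms] by simp

lemma vimage_one_point_map_in_borel:
  assumes "A \<in> sets borel"
  shows "one_point_map N M i -` A \<in> sets borel"
  using measurable_sets_borel[OF borel_measurable_one_point_map assms] by simp

lemma space_self_coupling: "self_coupling m \<Longrightarrow> space m = UNIV"
  using sets_eq_imp_space_eq[of m borel] by (simp add: self_coupling_def)

lemma mem_unit_square: "z \<in> unit_square \<longleftrightarrow> fst z \<in> {0..<1} \<and> snd z \<in> {0..<1}"
  by (cases z) (simp add: unit_square_def)

lemma self_coupling_slab_bound:
  assumes m: "self_coupling m"
    and XY: "X \<in> sets borel" "Y \<in> sets borel" and S: "S \<in> sets borel"
    and sub: "S \<subseteq> X \<times> UNIV \<union> UNIV \<times> Y"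
  shows "measure m S \<le> measure uniform_interval X + measure uniform_interval Y"
proof -
  interpret prob_space m using m by (simp add: self_coupling_def)
  have sets: "sets m = sets borel" using m by (simp add: self_coupling_def)
  have "X \<times> UNIV \<in> sets borel" "UNIV \<times> Y \<in> sets borel"
    using XY by (intro borel_Times; simp)+
  then have ev: "X \<times> UNIV \<in> events" "UNIV \<times> Y \<in> events" by (simp_all add: sets)
  have "measure m S \<le> measure m (X \<times> UNIV \<union> UNIV \<times> Y)"
    using ev sub by (intro finite_measure_mono) auto
  also have "\<dots> \<le> measure m (X \<times> UNIV) + measure m (UNIV \<times> Y)"
    using ev by (intro measure_Un_le)
  also have "\<dots> = measure uniform_interval X + measure uniform_interval Y"
    using m XY by (simp add: self_coupling_def)
  finally show ?thesis .
qed

lemma self_coupling_Int_unit_square: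
  assumes m: "self_coupling m" and A: "A \<in> sets borel"
  shows "measure m (A \<inter> unit_square) = measure m A"
proof -
  interpret prob_space m using m by (simp add: self_coupling_def)
  have sets: "sets m = sets borel" using m by (simp add: self_coupling_def)
  have "measure m (A - unit_square) \<le> measure uniform_interval (- {0..<1}) + measure uniform_interval (- {0..<1})"
    using A sets_unit_square by (intro self_coupling_slab_bound[OF m]) (auto simp: mem_unit_square)
  also have "\<dots> = 0" by (simp add: measure_uniform_interval)
  finally have "measure m (A - unit_square) = 0" by (simp add: antisym)
  moreover have "measure m A = measure m (A \<inter> unit_square) + measure m (A - unit_square)"
    using A sets_unit_square by (subst finite_measure_Union[symmetric]) (auto simp: sets Int_Diff_Un)
  ultimately show ?thesis by simp
qed

lemma measure_uniform_interval_translation: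
  "measure uniform_interval {x. x + s \<notin> {0..<1}} \<le> \<bar>s\<bar>"
proof -
  have eq: "{x. x + s \<notin> {0..<1}} = (\<lambda>x. x + s) -` (- {0..<1})" by auto
  have "measure uniform_interval {x. x + s \<notin> {0..<1}} = measure lborel ({x. x + s \<notin> {0..<1}} \<inter> {0..<1})"
    unfolding eq using measurable_sets_borel[of "\<lambda>x::real. x + s" borel "- {0..<1}"]
    by (subst measure_uniform_interval) auto
  also have "\<dots> \<le> measure lborel (if s < 0 then {0..-s} else {1-s..1})"
    by (intro measure_mono_fmeasurable fmeasurableI) (auto simp: eq)
  also have "\<dots> \<le> \<bar>s\<bar>" by auto
  finally show ?thesis .
qed

text \<open>One of the coordinates has to leave \<open>[0,1)\<close>, and each coordinate is uniformly distributed.\<close>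

lemma self_coupling_translation_out:
  assumes m: "self_coupling m"
  shows "measure m {z. z + t \<notin> unit_square} \<le> \<bar>fst t\<bar> + \<bar>snd t\<bar>"
proof -
  have b: "{x. x + s \<notin> {0..<1::real}} \<in> sets borel" for s
    using measurable_sets_borel[of "\<lambda>x::real. x + s" borel "- {0..<1}"] by (simp add: vimage_def)
  have "{z. z + t \<notin> unit_square} = (\<lambda>z. z + t) -` (- unit_square)" by auto
  then have "{z. z + t \<notin> unit_square} \<in> sets borel"
    using vimage_translation_in_borel[of "- unit_square" t] sets_unit_square by simp
  then have "measure m {z. z + t \<notin> unit_square} \<le>
    measure uniform_interval {x. x + fst t \<notin> {0..<1}} + measure uniform_interval {x. x + snd t \<notin> {0..<1}}"
    by (intro self_coupling_slab_bound[OF m] b) (auto simp: unit_square_def mem_Times_iff)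
  also have "\<dots> \<le> \<bar>fst t\<bar> + \<bar>snd t\<bar>"
    using measure_uniform_interval_translation by (intro add_mono)
  finally show ?thesis .
qed

lemma self_coupling_uniform_square: "self_coupling uniform_square"
proof -
  have "measure uniform_interval UNIV = 1" by (simp add: measure_uniform_interval)
  then show ?thesis
    by (simp add: self_coupling_def prob_space_uniform_square measure_uniform_square_Times)
qed

lemma self_coupling_distr_expand:
  assumes m: "self_coupling m" and N: "N > 0"
  shows "self_coupling (distr m borel (two_point_map N M 0))"
proof -
  interpret prob_space m using m by (simp add: self_coupling_def)
  have [measurable_cong, simp]: "sets m = sets borel" using m by (simp add: self_coupling_def)
  have "prob_space (distr m borel (two_point_map N M 0))"
    by (intro prob_space_distr) measurable
  moreover have "measure (distr m borel (two_point_map N M 0)) S = measure m (two_point_map N M 0 -` S)"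
    if "S \<in> sets borel" for S
    using that by (subst measure_distr) (auto simp: space_self_coupling[OF m])
  ultimately show ?thesis
    using m uniform_interval_expand[OF N] vimage_one_point_map_in_borel
    by (auto simp: self_coupling_def two_point_map_vimage_Times borel_Times)
qed

text \<open>Lebesgue measure is translation invariant, so only the points pushed over the boundary contribute.\<close>

lemma uniform_square_translation_defect: "translation_defect_le uniform_square r (2 * r)"
  unfolding translation_defect_le_def
proof (intro ballI allI impI)
  fix A :: "(real \<times> real) set" and t :: "real \<times> real"
  assume A: "A \<in> sets borel" and t: "\<bar>fst t\<bar> \<le> r" "\<bar>snd t\<bar> \<le> r"
  interpret prob_space uniform_square by (rule prob_space_uniform_square)
  define S where "S = A \<inter> unit_square \<inter> (\<lambda>z. z + (- t)) -` unit_square"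
  have "(\<lambda>z. z + (- t)) -` unit_square \<in> sets borel"
    using sets_unit_square by (rule vimage_translation_in_borel)
  then have S: "S \<in> sets borel" and out: "{z. z + (- t) \<notin> unit_square} \<in> sets borel"
    using A sets_unit_square by (auto simp: S_def vimage_def Collect_neg_eq)
  have eme: "measure uniform_square B = measure lborel (B \<inter> unit_square)" if "B \<in> sets borel" for B
    using that by (simp add: measure_def emeasure_uniform_square)
  have "measure uniform_square A = measure uniform_square (A \<inter> unit_square)"
    using self_coupling_Int_unit_square[OF self_coupling_uniform_square A] by simp
  also have "\<dots> \<le> measure uniform_square (S \<union> {z. z + (- t) \<notin> unit_square})"
    using S out by (intro finite_measure_mono) (auto simp: S_def)
  also have "\<dots> \<le> measure uniform_square S + measure uniform_square {z. z + (- t) \<notin> unit_square}"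
    using S out by (intro measure_Un_le) auto
  also have "measure uniform_square {z. z + (- t) \<notin> unit_square} \<le> 2 * r"
    using self_coupling_translation_out[OF self_coupling_uniform_square, of "- t"] t by simp
  also have "measure uniform_square S = measure lborel S"
    using S by (subst eme) (auto simp: S_def intro!: arg_cong[where f = "measure lborel"])
  also have "\<dots> = measure lborel ((\<lambda>z. z + t) -` S)"
  proof -
    have "emeasure lborel S = emeasure (distr lborel borel ((+) t)) S"
      by (simp add: lborel_distr_plus)
    also have "\<dots> = emeasure lborel ((\<lambda>z. z + t) -` S)"
      using S by (subst emeasure_distr) (auto simp: vimage_def add.commute)
    finally show ?thesis by (simp add: measure_def)
  qed
  also have "\<dots> = measure uniform_square ((\<lambda>z. z + t) -` S)"
  proof -
    have "z \<in> unit_square" if "z + t \<in> S" for z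
      using that unfolding S_def by simp
    then have "(\<lambda>z. z + t) -` S \<inter> unit_square = (\<lambda>z. z + t) -` S" by blast
    then show ?thesis using eme[OF vimage_translation_in_borel[OF S, of t]] by simp
  qed
  also have "\<dots> \<le> measure uniform_square ((\<lambda>z. z + t) -` A)"
    using vimage_translation_in_borel[OF A, of t] by (intro finite_measure_mono) (auto simp: S_def)
  finally show "measure uniform_square A \<le> measure uniform_square ((\<lambda>z. z + t) -` A) + 2 * r" by simp
qed

text \<open>On the torus, \<open>f\<^sub>0 (z + t / N) = f\<^sub>0 z + t\<close>. In the square this can fail only where a coordinate wraps around, that
  is, where \<open>f\<^sub>0 z\<close> is within \<open>r\<close> of the boundary. The mass of these points is controlled by the marginals of the
  image measure alone, however concentrated \<open>m\<close> is in two dimensions.\<close>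

lemma translation_defect_expand:
  assumes m: "self_coupling m" and N: "N > 0" and defect: "translation_defect_le m (r / real N) d"
    and A: "A \<in> sets borel" and t: "\<bar>fst t\<bar> \<le> r" "\<bar>snd t\<bar> \<le> r"
  shows "measure m (two_point_map N M 0 -` A)
    \<le> measure m (two_point_map N M 0 -` ((\<lambda>z. z + t) -` A)) + d + 2 * r"
proof -
  let ?f = "two_point_map N M 0"
  interpret prob_space m using m by (simp add: self_coupling_def)
  have [measurable_cong, simp]: "sets m = sets borel" using m by (simp add: self_coupling_def)
  \<comment> \<open>The part of \<open>A\<close> that can be reached by the shift from within the square.\<close>
  define S where "S = A \<inter> (\<lambda>z. z + (- t)) -` unit_square"
  have "(\<lambda>z. z + (- t)) -` unit_square \<in> sets borel"
    using sets_unit_square by (rule vimage_translation_in_borel)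
  then have S: "S \<in> sets borel" and out: "{z. z + (- t) \<notin> unit_square} \<in> sets borel"
    using A by (auto simp: S_def vimage_def Collect_neg_eq)
  note b = vimage_two_point_map_in_borel
  define u where "u = (fst t / real N, snd t / real N)"
  have out_bound: "measure m (?f -` {z. z + (- t) \<notin> unit_square}) \<le> 2 * r"
  proof -
    have "measure m (?f -` {z. z + (- t) \<notin> unit_square}) = measure (distr m borel ?f) {z. z + (- t) \<notin> unit_square}"
      using out by (subst measure_distr) (auto simp: space_self_coupling[OF m])
    also have "\<dots> \<le> 2 * r"
      using self_coupling_translation_out[OF self_coupling_distr_expand[OF m N, of M], of "- t"] t by simp
    finally show ?thesis .
  qed
  have shift: "(\<lambda>z. z + u) -` (?f -` S) \<subseteq> ?f -` ((\<lambda>z. z + t) -` A)"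
  proof
    fix z assume "z \<in> (\<lambda>z. z + u) -` (?f -` S)"
    then have a: "?f (z + u) \<in> A" and sq: "?f (z + u) - t \<in> unit_square" unfolding S_def by simp_all
    have frac_shift: "frac (real N * x) + s = frac (real N * (x + s / real N))"
      if "frac (real N * (x + s / real N)) - s \<in> {0..<1}" for x s
    proof -
      have "real N * (x + s / real N) = real N * x + s" using N by (simp add: field_simps)
      then have "frac (real N * x) = frac (real N * (x + s / real N)) - s"
        using that unfolding frac_unique_iff by (simp add: frac_def)
      then show ?thesis by simp
    qed
    have "?f z + t = ?f (z + u)"
      using sq frac_shift[of "fst z" "fst t"] frac_shift[of "snd z" "snd t"]
      by (simp add: two_point_map_def one_point_map_def u_def mem_unit_square prod_eq_iff)
    then show "z \<in> ?f -` ((\<lambda>z. z + t) -` A)" using a by simp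
  qed
  have "measure m (?f -` A) \<le> measure m (?f -` S \<union> ?f -` {z. z + (- t) \<notin> unit_square})"
    using b[OF S] b[OF out] by (intro finite_measure_mono) (auto simp: S_def)
  also have "\<dots> \<le> measure m (?f -` S) + measure m (?f -` {z. z + (- t) \<notin> unit_square})"
    using b[OF S] b[OF out] by (intro measure_Un_le) auto
  also have "measure m (?f -` S) \<le> measure m ((\<lambda>z. z + u) -` (?f -` S)) + d"
    using t N by (intro translation_defect_leD[OF defect b[OF S]]) (auto simp: u_def divide_right_mono)
  also have "measure m ((\<lambda>z. z + u) -` (?f -` S)) \<le> measure m (?f -` ((\<lambda>z. z + t) -` A))"
    using b[OF vimage_translation_in_borel[OF A]] shift by (intro finite_measure_mono) auto
  finally show ?thesis using out_bound by simp
qed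

text \<open>Contractions are affine on the whole plane and commute with translations exactly, up to the factor \<open>M\<close>.\<close>

lemma translation_defect_contract:
  assumes M: "M > 0" and i: "i > 0" and defect: "translation_defect_le m (real M * r) d"
    and A: "A \<in> sets borel" and t: "\<bar>fst t\<bar> \<le> r" "\<bar>snd t\<bar> \<le> r"
  shows "measure m (two_point_map N M i -` A)
    \<le> measure m (two_point_map N M i -` ((\<lambda>z. z + t) -` A)) + d"
proof -
  define u where "u = (real M * fst t, real M * snd t)"
  have "two_point_map N M i (z + u) = two_point_map N M i z + t" for z
    using M i by (auto simp: two_point_map_def one_point_map_def u_def prod_eq_iff field_simps)
  then have "(\<lambda>z. z + u) -` (two_point_map N M i -` A) = two_point_map N M i -` ((\<lambda>z. z + t) -` A)"
    by (simp add: vimage_def)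
  moreover have "measure m (two_point_map N M i -` A)
    \<le> measure m ((\<lambda>z. z + u) -` (two_point_map N M i -` A)) + d"
    using t M by (intro translation_defect_leD[OF defect vimage_two_point_map_in_borel[OF A]])
      (auto simp: u_def abs_mult)
  ultimately show ?thesis by simp
qed

text \<open>Average \<open>m A \<le> m (A - t) + d\<close> over \<open>t \<in> [0,r]\<^sup>2\<close>. By Tonelli, the integral of \<open>m (A - t)\<close> over all \<open>t\<close> is the Lebesgue
  measure of \<open>A\<close>.\<close>

lemma measure_le_lborel_of_translation_defect:
  assumes "prob_space m" and sets: "sets m = sets borel"
    and defect: "translation_defect_le m r d" and r: "r > 0" and A: "A \<in> sets borel"
    and fin: "emeasure lborel A < \<infinity>"
  shows "measure m A \<le> measure lborel A / r\<^sup>2 + d"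
proof -
  interpret prob_space m by fact
  note [measurable_cong] = sets
  have [measurable]: "A \<in> sets borel" by (rule A)
  have d: "d \<ge> 0"
    using translation_defect_leD[OF defect, of "{}" 0] r by simp
  define Q :: "(real \<times> real) set" where "Q = {0..r} \<times> {0..r}"
  have Q: "Q \<in> sets borel" unfolding Q_def by (intro borel_Times) auto
  then have [measurable]: "Q \<in> sets borel" .
  have eQ: "emeasure lborel Q = ennreal (r\<^sup>2)"
    unfolding Q_def lborel_prod[symmetric] using r
    by (subst lborel.emeasure_pair_measure_Times) (auto simp: ennreal_mult power2_eq_square)
  have ms: "(\<lambda>(t, z). indicator A (t + z) :: ennreal) \<in> borel_measurable (lborel \<Otimes>\<^sub>M m)"
    by measurable
  have sp: "space m = UNIV" using sets_eq_imp_space_eq[OF sets] by simp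
  have inner: "emeasure m ((\<lambda>z. z + t) -` A) = (\<integral>\<^sup>+z. indicator A (t + z) \<partial>m)" for t
  proof -
    have "(\<integral>\<^sup>+z. indicator A (t + z) \<partial>m) = (\<integral>\<^sup>+z. indicator ((\<lambda>z. z + t) -` A) z \<partial>m)"
      by (intro nn_integral_cong) (auto simp: add.commute split: split_indicator)
    then show ?thesis using vimage_translation_in_borel[OF A] by (simp add: sets)
  qed
  interpret pair_sigma_finite lborel m ..
  have "ennreal (measure m A) * ennreal (r\<^sup>2) = (\<integral>\<^sup>+t. ennreal (measure m A) * indicator Q t \<partial>lborel)"
    using Q by (subst nn_integral_cmult_indicator) (auto simp: eQ)
  also have "\<dots> \<le> (\<integral>\<^sup>+t. (\<integral>\<^sup>+z. indicator A (t + z) \<partial>m) + ennreal d * indicator Q t \<partial>lborel)"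
  proof (intro nn_integral_mono)
    fix t :: "real \<times> real"
    show "ennreal (measure m A) * indicator Q t \<le> (\<integral>\<^sup>+z. indicator A (t + z) \<partial>m) + ennreal d * indicator Q t"
    proof (cases "t \<in> Q")
      case True
      then have "measure m A \<le> measure m ((\<lambda>z. z + t) -` A) + d"
        by (intro translation_defect_leD[OF defect A]) (auto simp: Q_def)
      then have "ennreal (measure m A) \<le> ennreal (measure m ((\<lambda>z. z + t) -` A)) + ennreal d"
        using d by (simp flip: ennreal_plus)
      then show ?thesis using True by (simp add: emeasure_eq_measure flip: inner)
    qed simp
  qed
  also have "\<dots> = (\<integral>\<^sup>+t. \<integral>\<^sup>+z. indicator A (t + z) \<partial>m \<partial>lborel) + ennreal d * ennreal (r\<^sup>2)"
    using Q by (subst nn_integral_add) (auto simp: nn_integral_cmult_indicator eQ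
        intro!: borel_measurable_nn_integral ms)
  also have "(\<integral>\<^sup>+t. \<integral>\<^sup>+z. indicator A (t + z) \<partial>m \<partial>lborel) = (\<integral>\<^sup>+z. \<integral>\<^sup>+t. indicator A (t + z) \<partial>lborel \<partial>m)"
    using Fubini'[OF ms] by simp
  also have "\<dots> = (\<integral>\<^sup>+z. emeasure lborel A \<partial>m)"
  proof (intro nn_integral_cong)
    fix z :: "real \<times> real"
    have "emeasure lborel A = (\<integral>\<^sup>+t. indicator A t \<partial>distr lborel borel ((+) z))"
      by (simp add: lborel_distr_plus)
    also have "\<dots> = (\<integral>\<^sup>+t. indicator A (t + z) \<partial>lborel)"
      by (subst nn_integral_distr) (auto simp: add.commute)
    finally show "(\<integral>\<^sup>+t. indicator A (t + z) \<partial>lborel) = emeasure lborel A" ..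
  qed
  also have "\<dots> = ennreal (measure lborel A)"
    using fin by (simp add: emeasure_space_1 emeasure_eq_ennreal_measure)
  finally have "measure m A * r\<^sup>2 \<le> measure lborel A + d * r\<^sup>2"
    using d by (simp flip: ennreal_plus ennreal_mult)
  then show ?thesis using r by (simp add: field_simps)
qed

section \<open>Setwise limits of uniformly absolutely continuous measures\<close>

text \<open>Uniform absolute continuity makes the mass of the tail of a countable disjoint union small uniformly in
  \<open>n\<close>. Hence the sets on which the measures converge form a Dynkin system, and the limit is continuous at
  the empty set.\<close>

lemma uniformly_absolutely_continuous_limit:
  fixes \<mu> :: "nat \<Rightarrow> 'a measure"
  assumes K: "finite_measure K"
    and prob: "\<And>n. prob_space (\<mu> n)"
    and sets: "\<And>n. sets (\<mu> n) = sets K"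
    and uac: "\<And>e. e > 0 \<Longrightarrow> \<exists>d>0. \<forall>n. \<forall>A\<in>sets K. measure K A < d \<longrightarrow> measure (\<mu> n) A < e"
    and gen: "sets K = sigma_sets (space K) E" "Int_stable E" "E \<subseteq> Pow (space K)"
    and conv: "\<And>A. A \<in> E \<Longrightarrow> convergent (\<lambda>n. measure (\<mu> n) A)"
  shows "\<exists>m. prob_space m \<and> sets m = sets K \<and> (\<forall>A\<in>sets K. (\<lambda>n. measure (\<mu> n) A) \<longlonglongrightarrow> measure m A)"
proof -
  interpret K: finite_measure K by (rule K)
  have space: "space (\<mu> n) = space K" for n
    using sets by (rule sets_eq_imp_space_eq)
  have vanish: "\<exists>k. \<forall>n. measure (\<mu> n) (B k) < e"
    if B: "range B \<subseteq> sets K" "decseq B" "(\<Inter>i. B i) = {}" and "e > 0" for B :: "nat \<Rightarrow> 'a set" and e :: real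
  proof -
    obtain d where d: "d > 0" "\<And>n A. A \<in> sets K \<Longrightarrow> measure K A < d \<Longrightarrow> measure (\<mu> n) A < e"
      using uac[OF \<open>e > 0\<close>] by blast
    have "(\<lambda>k. measure K (B k)) \<longlonglongrightarrow> 0"
      using K.finite_Lim_measure_decseq[OF B(1,2)] B(3) by simp
    then have "\<forall>\<^sub>F k in sequentially. measure K (B k) < d"
      using d(1) by (rule order_tendstoD)
    then obtain k where "measure K (B k) < d" by (auto simp: eventually_sequentially)
    then show ?thesis using d(2) B(1) by blast
  qed
  have convergent: "convergent (\<lambda>n. measure (\<mu> n) A)" if "A \<in> sets K" for A
  proof -
    from that have "A \<in> sigma_sets (space K) E" by (simp add: gen(1))
    with gen(2,3) show ?thesis
    proof (induction A rule: sigma_sets_induct_disjoint)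
      case (compl A)
      then have "A \<in> sets K" by (simp add: gen(1))
      then have "measure (\<mu> n) (space K - A) = 1 - measure (\<mu> n) A" for n
        using prob_space.prob_compl[OF prob, of A n] by (simp add: sets space)
      then show ?case using convergent_diff[OF convergent_const compl(2)] by simp
    next
      case (union A)
      have A: "range A \<subseteq> sets K" using union(2) by (simp add: gen(1))
      define B where "B k = (\<Union>i. A (i + k))" for k
      have B: "range B \<subseteq> sets K" using A by (auto simp: B_def)
      have dec: "decseq B"
      proof (rule decseq_SucI)
        show "B (Suc k) \<subseteq> B k" for k
          unfolding B_def by (auto; metis add_Suc)
      qed
      have "(\<Inter>k. B k) = {}"
      proof (rule ccontr)
        assume "(\<Inter>k. B k) \<noteq> {}"
        then obtain x where "x \<in> (\<Inter>k. B k)" by blast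
        then have x: "\<exists>i. x \<in> A (i + k)" for k by (simp add: B_def)
        obtain i where i: "x \<in> A i" using x[of 0] by auto
        obtain j where "x \<in> A (j + Suc i)" using x[of "Suc i"] by blast
        moreover have "j + Suc i \<noteq> i" by simp
        ultimately show False
          using i disjoint_family_onD[OF union(1), of i "j + Suc i"] by auto
      qed
      note vanish = vanish[OF B dec this]
      have split: "measure (\<mu> n) (\<Union>i. A i) = (\<Sum>i<k. measure (\<mu> n) (A i)) + measure (\<mu> n) (B k)" for n k
      proof -
        interpret P: prob_space "\<mu> n" by (rule prob)
        have sets': "range A \<subseteq> P.events" using A by (simp add: sets)
        have s: "(\<lambda>i. measure (\<mu> n) (A i)) sums measure (\<mu> n) (\<Union>i. A i)"
          using P.finite_measure_UNION[OF sets' union(1)] .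
        have d: "disjoint_family (\<lambda>i. A (i + k))"
          using union(1) by (auto simp: disjoint_family_on_def)
        have "(\<lambda>i. measure (\<mu> n) (A (i + k))) sums measure (\<mu> n) (B k)"
          unfolding B_def using sets' by (intro P.finite_measure_UNION d) auto
        then have "measure (\<mu> n) (B k) + (\<Sum>i<k. measure (\<mu> n) (A i)) = measure (\<mu> n) (\<Union>i. A i)"
          by (rule sums_unique2[OF iffD1[OF sums_iff_shift] s])
        then show ?thesis by simp
      qed
      show ?case
        unfolding Cauchy_convergent_iff[symmetric]
      proof (rule metric_CauchyI)
        fix e :: real assume "e > 0"
        then obtain k where k: "\<And>n. measure (\<mu> n) (B k) < e / 2" using vanish[of "e / 2"] by auto
        have "convergent (\<lambda>n. \<Sum>i<k. measure (\<mu> n) (A i))"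
          using union(3) by (intro convergent_sum) auto
        then have "Cauchy (\<lambda>n. \<Sum>i<k. measure (\<mu> n) (A i))" by (rule convergent_Cauchy)
        then obtain n0 where n0: "\<And>m n. m \<ge> n0 \<Longrightarrow> n \<ge> n0 \<Longrightarrow>
          dist (\<Sum>i<k. measure (\<mu> m) (A i)) (\<Sum>i<k. measure (\<mu> n) (A i)) < e / 2"
          using \<open>e > 0\<close> by (meson half_gt_zero metric_CauchyD)
        show "\<exists>n0. \<forall>m\<ge>n0. \<forall>n\<ge>n0. dist (measure (\<mu> m) (\<Union>i. A i)) (measure (\<mu> n) (\<Union>i. A i)) < e"
        proof (intro exI allI impI)
          fix m n assume "m \<ge> n0" "n \<ge> n0"
          moreover have "measure (\<mu> m) (B k) \<ge> 0" "measure (\<mu> n) (B k) \<ge> 0" by simp_all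
          ultimately show "dist (measure (\<mu> m) (\<Union>i. A i)) (measure (\<mu> n) (\<Union>i. A i)) < e"
            using n0[of m n] k[of m] k[of n] unfolding split[of _ k] dist_real_def by linarith
        qed
      qed
    qed (use conv in \<open>auto simp: convergent_const\<close>)
  qed
  define L where "L A = lim (\<lambda>n. measure (\<mu> n) A)" for A
  have L: "(\<lambda>n. measure (\<mu> n) A) \<longlonglongrightarrow> L A" if "A \<in> sets K" for A
    using convergent[OF that] by (simp add: L_def convergent_LIMSEQ_iff)
  have L_nonneg: "L A \<ge> 0" if "A \<in> sets K" for A
    using L[OF that] by (rule LIMSEQ_le_const) simp
  have add: "additive (sets K) (\<lambda>A. ennreal (L A))"
    unfolding additive_def
  proof (intro ballI impI)
    fix A B assume AB: "A \<in> sets K" "B \<in> sets K" "A \<inter> B = {}"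
    have "measure (\<mu> n) (A \<union> B) = measure (\<mu> n) A + measure (\<mu> n) B" for n
    proof -
      interpret P: prob_space "\<mu> n" by (rule prob)
      show ?thesis using AB by (intro P.finite_measure_Union) (auto simp: sets)
    qed
    then have "(\<lambda>n. measure (\<mu> n) (A \<union> B)) \<longlonglongrightarrow> L A + L B"
      using tendsto_add[OF L[OF AB(1)] L[OF AB(2)]] by simp
    then have "L (A \<union> B) = L A + L B" using L[of "A \<union> B"] AB by (blast intro: LIMSEQ_unique)
    then show "ennreal (L (A \<union> B)) = ennreal (L A) + ennreal (L B)"
      using L_nonneg AB by (simp add: ennreal_plus)
  qed
  have pos: "positive (sets K) (\<lambda>A. ennreal (L A))"
    by (simp add: positive_def L_def)
  have ca: "countably_additive (sets K) (\<lambda>A. ennreal (L A))"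
  proof (rule sets.empty_continuous_imp_countably_additive[OF pos add])
    fix B :: "nat \<Rightarrow> 'a set" assume B: "range B \<subseteq> sets K" "decseq B" "(\<Inter>i. B i) = {}"
    have "(\<lambda>k. L (B k)) \<longlonglongrightarrow> 0"
    proof (rule LIMSEQ_I)
      fix e :: real assume "e > 0"
      then obtain k where k: "\<And>n. measure (\<mu> n) (B k) < e / 2" using vanish[OF B, of "e / 2"] by auto
      have "norm (L (B j) - 0) < e" if "j \<ge> k" for j
      proof -
        have Bj: "B j \<in> sets K" "B k \<in> sets K" using B(1) by auto
        have "measure (\<mu> n) (B j) \<le> e / 2" for n
        proof -
          interpret P: prob_space "\<mu> n" by (rule prob)
          have "measure (\<mu> n) (B j) \<le> measure (\<mu> n) (B k)"
            using decseqD[OF B(2) that] Bj by (intro P.finite_measure_mono) (auto simp: sets)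
          then show ?thesis using k[of n] by simp
        qed
        then have "L (B j) \<le> e / 2" by (intro LIMSEQ_le_const2[OF L[OF Bj(1)]]) auto
        then show ?thesis using L_nonneg[OF Bj(1)] \<open>e > 0\<close> by simp
      qed
      then show "\<exists>k. \<forall>j\<ge>k. norm (L (B j) - 0) < e" by blast
    qed
    then show "(\<lambda>k. ennreal (L (B k))) \<longlonglongrightarrow> 0"
      using tendsto_ennrealI by force
  qed simp
  define m where "m = measure_of (space K) (sets K) (\<lambda>A. ennreal (L A))"
  have m_sets: "sets m = sets K" by (simp add: m_def)
  have m_emeasure: "emeasure m A = ennreal (L A)" if "A \<in> sets K" for A
    unfolding m_def using pos ca that by (intro emeasure_measure_of_sigma) (auto intro: sets.sigma_algebra_axioms)
  have "L (space K) = 1"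
  proof -
    have "measure (\<mu> n) (space K) = 1" for n
      using prob_space.prob_space[OF prob, of n] by (simp add: space)
    then show ?thesis by (simp add: L_def)
  qed
  then have "prob_space m"
    using m_sets m_emeasure by (intro prob_spaceI) (simp add: sets_eq_imp_space_eq[OF m_sets])
  moreover have "(\<lambda>n. measure (\<mu> n) A) \<longlonglongrightarrow> measure m A" if "A \<in> sets K" for A
    using L[OF that] L_nonneg[OF that] m_emeasure[OF that] by (simp add: measure_def)
  ultimately show ?thesis using m_sets by blast
qed

section \<open>Laws of the two-point motion started from Lebesgue measure\<close>

text \<open>The averaged transfer operator \<open>m \<mapsto> (\<Sum>i. p\<^sub>i (f\<^sub>i)\<^sub>* m)\<close>; its fixed points are the stationary measures.\<close>

definition annealed_push :: "nat \<Rightarrow> nat \<Rightarrow> real \<Rightarrow> (real \<times> real) measure \<Rightarrow> (real \<times> real) measure" where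
  "annealed_push N M p0 m = measure_of UNIV (sets borel)
     (\<lambda>A. \<Sum>i = 0..M. ennreal (map_prob M p0 i) * emeasure m (two_point_map N M i -` A))"

definition two_point_law :: "nat \<Rightarrow> nat \<Rightarrow> real \<Rightarrow> nat \<Rightarrow> (real \<times> real) measure" where
  "two_point_law N M p0 n = (annealed_push N M p0 ^^ n) uniform_square"

lemma sets_annealed_push [simp]: "sets (annealed_push N M p0 m) = sets borel"
  unfolding annealed_push_def using sets.sets_measure_of_eq[of borel] by simp

lemma emeasure_annealed_push:
  assumes m: "sets m = sets borel" and A: "A \<in> sets borel"
  shows "emeasure (annealed_push N M p0 m) A =
    (\<Sum>i = 0..M. ennreal (map_prob M p0 i) * emeasure m (two_point_map N M i -` A))"
proof (rule emeasure_measure_of[OF annealed_push_def])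
  show "countably_additive (sets (annealed_push N M p0 m))
     (\<lambda>A. \<Sum>i = 0..M. ennreal (map_prob M p0 i) * emeasure m (two_point_map N M i -` A))"
  proof (rule countably_additiveI)
    fix B :: "nat \<Rightarrow> (real \<times> real) set"
    assume B: "range B \<subseteq> sets (annealed_push N M p0 m)" "disjoint_family B"
    have B': "range (\<lambda>k. two_point_map N M i -` B k) \<subseteq> sets m" for i
      using B(1) vimage_two_point_map_in_borel by (auto simp: m)
    have "disjoint_family (\<lambda>k. two_point_map N M i -` B k)" for i
      using B(2) unfolding disjoint_family_on_def by blast
    then have "(\<Sum>k. emeasure m (two_point_map N M i -` B k)) = emeasure m (two_point_map N M i -` (\<Union>k. B k))" for i
      using suminf_emeasure[OF B', of i] by (simp add: vimage_UN)
    then show "(\<Sum>k. \<Sum>i = 0..M. ennreal (map_prob M p0 i) * emeasure m (two_point_map N M i -` B k)) =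
        (\<Sum>i = 0..M. ennreal (map_prob M p0 i) * emeasure m (two_point_map N M i -` (\<Union>k. B k)))"
      by (subst suminf_sum) auto
  qed
qed (auto simp: A positive_def)

lemma sum_map_prob:
  assumes "M > 0"
  shows "(\<Sum>i = 0..M. map_prob M p0 i * g i) = p0 * g 0 + (1 - p0) / real M * (\<Sum>i = 1..M. g i)"
proof -
  have "(\<Sum>i = 0..M. map_prob M p0 i * g i) = p0 * g 0 + (\<Sum>i = 1..M. map_prob M p0 i * g i)"
    by (simp add: sum.atLeast_Suc_atMost map_prob_def)
  also have "(\<Sum>i = 1..M. map_prob M p0 i * g i) = (1 - p0) / real M * (\<Sum>i = 1..M. g i)"
    unfolding sum_distrib_left by (intro sum.cong) (auto simp: map_prob_def)
  finally show ?thesis .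
qed

lemma map_prob_nonneg: "0 \<le> p0 \<Longrightarrow> p0 \<le> 1 \<Longrightarrow> 0 \<le> map_prob M p0 i"
  by (simp add: map_prob_def)

lemma sum_map_prob_eq_1: "M > 0 \<Longrightarrow> (\<Sum>i = 0..M. map_prob M p0 i) = 1"
  using sum_map_prob[of M p0 "\<lambda>_. 1"] by simp

lemma measure_annealed_push:
  assumes m: "finite_measure m" "sets m = sets borel" and A: "A \<in> sets borel" and p: "0 \<le> p0" "p0 \<le> 1"
  shows "measure (annealed_push N M p0 m) A =
    (\<Sum>i = 0..M. map_prob M p0 i * measure m (two_point_map N M i -` A))"
proof -
  have "emeasure (annealed_push N M p0 m) A =
      (\<Sum>i = 0..M. ennreal (map_prob M p0 i * measure m (two_point_map N M i -` A)))"
    unfolding emeasure_annealed_push[OF m(2) A] using map_prob_nonneg[OF p]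
    by (simp add: finite_measure.emeasure_eq_measure[OF m(1)] ennreal_mult)
  also have "\<dots> = ennreal (\<Sum>i = 0..M. map_prob M p0 i * measure m (two_point_map N M i -` A))"
    using map_prob_nonneg[OF p] by (intro sum_ennreal) simp
  finally show ?thesis
    using map_prob_nonneg[OF p] by (simp add: measure_def sum_nonneg)
qed

lemma uniform_interval_stationary:
  assumes "N > 0" "M > 0" "A \<in> sets borel"
  shows "(\<Sum>i = 0..M. map_prob M p0 i * measure uniform_interval (one_point_map N M i -` A))
    = measure uniform_interval A"
  unfolding sum_map_prob[OF assms(2)] uniform_interval_expand[OF assms(1,3)]
    uniform_interval_contract[OF assms(2,3)]
  using assms(2) by (simp add: field_simps)

lemma self_coupling_annealed_push:
  assumes m: "self_coupling m" and NM: "N > 0" "M > 0" and p: "0 \<le> p0" "p0 \<le> 1"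
  shows "self_coupling (annealed_push N M p0 m)"
proof -
  interpret prob_space m using m by (simp add: self_coupling_def)
  have sets: "sets m = sets borel" using m by (simp add: self_coupling_def)
  note push = measure_annealed_push[OF finite_measure_axioms sets _ p, of _ N M]
  have "emeasure (annealed_push N M p0 m) UNIV = (\<Sum>i = 0..M. ennreal (map_prob M p0 i))"
    using emeasure_annealed_push[OF sets, of UNIV N M p0] emeasure_space_1
    by (simp add: space_self_coupling[OF m])
  also have "\<dots> = 1"
    using sum_map_prob_eq_1[OF NM(2)] map_prob_nonneg[OF p] by (simp add: sum_ennreal)
  finally have "prob_space (annealed_push N M p0 m)"
    using sets_eq_imp_space_eq[of "annealed_push N M p0 m" borel] by (intro prob_spaceI) simp
  moreover have "measure (annealed_push N M p0 m) (A \<times> UNIV) = measure uniform_interval A"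
    "measure (annealed_push N M p0 m) (UNIV \<times> A) = measure uniform_interval A"
    if A: "A \<in> sets borel" for A
    using m A uniform_interval_stationary[OF NM A, of p0] vimage_one_point_map_in_borel[OF A]
    by (simp_all add: push borel_Times two_point_map_vimage_Times self_coupling_def)
  ultimately show ?thesis by (simp add: self_coupling_def)
qed

lemma two_point_law_0 [simp]: "two_point_law N M p0 0 = uniform_square"
  and two_point_law_Suc [simp]: "two_point_law N M p0 (Suc n) = annealed_push N M p0 (two_point_law N M p0 n)"
  by (simp_all add: two_point_law_def)

lemma self_coupling_two_point_law:
  assumes "N > 0" "M > 0" "0 \<le> p0" "p0 \<le> 1"
  shows "self_coupling (two_point_law N M p0 n)"
  using assms by (induction n) (simp_all add: self_coupling_uniform_square self_coupling_annealed_push)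

lemma measure_two_point_law_Suc:
  assumes "N > 0" "M > 0" "0 \<le> p0" "p0 \<le> 1" "A \<in> sets borel"
  shows "measure (two_point_law N M p0 (Suc n)) A =
    (\<Sum>i = 0..M. map_prob M p0 i * measure (two_point_law N M p0 n) (two_point_map N M i -` A))"
proof -
  interpret prob_space "two_point_law N M p0 n"
    using self_coupling_two_point_law[OF assms(1-4), of n] by (simp add: self_coupling_def)
  have "sets (two_point_law N M p0 n) = sets borel"
    using self_coupling_two_point_law[OF assms(1-4), of n] by (simp add: self_coupling_def)
  then show ?thesis
    unfolding two_point_law_Suc by (rule measure_annealed_push[OF finite_measure_axioms _ assms(5,3,4)])
qed

lemma translation_defect_annealed_push:
  assumes m: "self_coupling m" and NM: "N > 0" "M > 0" and p: "0 \<le> p0" "p0 \<le> 1"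
    and d: "translation_defect_le m (r / real N) d" "translation_defect_le m (real M * r) d'"
    and r: "r \<ge> 0"
  shows "translation_defect_le (annealed_push N M p0 m) r (p0 * d + (1 - p0) * d' + 2 * r)"
  unfolding translation_defect_le_def
proof (intro ballI allI impI)
  fix A :: "(real \<times> real) set" and t :: "real \<times> real"
  assume A: "A \<in> sets borel" and t: "\<bar>fst t\<bar> \<le> r" "\<bar>snd t\<bar> \<le> r"
  interpret prob_space m using m by (simp add: self_coupling_def)
  have sets: "sets m = sets borel" using m by (simp add: self_coupling_def)
  let ?g = "\<lambda>i B. measure m (two_point_map N M i -` B)" and ?At = "(\<lambda>z. z + t) -` A"
  have push: "measure (annealed_push N M p0 m) B = p0 * ?g 0 B + (1 - p0) / real M * (\<Sum>i = 1..M. ?g i B)"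
    if "B \<in> sets borel" for B
    by (simp add: measure_annealed_push[OF finite_measure_axioms sets that p] sum_map_prob NM)
  have "(\<Sum>i = 1..M. ?g i A) \<le> (\<Sum>i = 1..M. ?g i ?At + d')"
    using translation_defect_contract[OF NM(2) _ d(2) A t] by (intro sum_mono) auto
  then have "(1 - p0) / real M * (\<Sum>i = 1..M. ?g i A) \<le> (1 - p0) / real M * (\<Sum>i = 1..M. ?g i ?At + d')"
    using p by (intro mult_left_mono) auto
  also have "\<dots> = (1 - p0) / real M * (\<Sum>i = 1..M. ?g i ?At) + (1 - p0) * d'"
    using NM by (simp add: sum.distrib distrib_left)
  finally have contract: "(1 - p0) / real M * (\<Sum>i = 1..M. ?g i A) \<le> \<dots>" .
  have "p0 * ?g 0 A \<le> p0 * (?g 0 ?At + d + 2 * r)"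
    using translation_defect_expand[OF m NM(1) d(1) A t] p by (intro mult_left_mono) auto
  also have "\<dots> \<le> p0 * ?g 0 ?At + p0 * d + 2 * r"
    using p r by (simp add: distrib_left mult_left_le_one_le)
  finally show "measure (annealed_push N M p0 m) A
      \<le> measure (annealed_push N M p0 m) ?At + (p0 * d + (1 - p0) * d' + 2 * r)"
    using contract by (simp add: push A vimage_translation_in_borel)
qed

text \<open>The left-hand side of the last inequality has the derivative \<open>-L\<close> at \<open>s = 0\<close>, where its value is \<open>1\<close>. This is the only place where
  positivity of the Lyapunov exponent enters.\<close>

lemma exists_contracting_exponent:
  assumes "N > 0" "M > 0" "lyapunov_exponent N M p0 > 0"
  shows "\<exists>s>0. s \<le> 1 \<and> p0 * real N powr (- s) + (1 - p0) * real M powr s < 1"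
proof -
  let ?f = "\<lambda>s. p0 * exp (- s * ln (real N)) + (1 - p0) * exp (s * ln (real M))"
  have deriv: "DERIV ?f 0 :> - lyapunov_exponent N M p0"
    by (auto intro!: derivative_eq_intros simp: lyapunov_exponent_def)
  have "\<exists>d>0. \<forall>h>0. h < d \<longrightarrow> ?f (0 + h) < ?f 0"
    using assms(3) by (intro DERIV_neg_dec_right[OF deriv]) linarith
  then obtain d where d: "d > 0" "\<And>h. h > 0 \<Longrightarrow> h < d \<Longrightarrow> ?f h < 1" by auto
  define s where "s = min (d / 2) 1"
  have s: "s > 0" "s < d" "s \<le> 1" using d(1) by (auto simp: s_def)
  have "p0 * real N powr (- s) + (1 - p0) * real M powr s < 1"
    using d(2)[OF s(1,2)] assms(1,2) by (simp add: powr_def)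
  then show ?thesis using s by blast
qed

text \<open>With \<open>q = p\<^sub>0 N\<^sup>-\<^sup>s + (1 - p\<^sub>0) M\<^sup>s < 1\<close>, the bound \<open>C r\<^sup>s\<close> reproduces itself under the recursion for the defects
  as soon as \<open>C q r\<^sup>s + 2 r \<le> C r\<^sup>s\<close>. For \<open>r \<le> 1\<close> it suffices that \<open>C q + 2 = C\<close>, since \<open>r \<le> r\<^sup>s\<close>; for \<open>r > 1\<close> the bound
  exceeds \<open>1\<close> and is trivial.\<close>

lemma two_point_law_translation_defect:
  assumes NM: "N > 0" "M > 0" and p: "0 \<le> p0" "p0 \<le> 1"
    and s: "0 < s" "s \<le> 1" "p0 * real N powr (- s) + (1 - p0) * real M powr s < 1"
  shows "\<exists>C. \<forall>n r. r > 0 \<longrightarrow> translation_defect_le (two_point_law N M p0 n) r (C * r powr s)"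
proof -
  define q where "q = p0 * real N powr (- s) + (1 - p0) * real M powr s"
  have q: "0 \<le> q" "q < 1" using p s by (auto simp: q_def)
  define C where "C = 2 / (1 - q)"
  have C: "C \<ge> 2" "C * q + 2 = C" using q by (auto simp: C_def field_simps)
  have small: "translation_defect_le m r (C * r powr s)"
    if m: "self_coupling m" and r: "r > 0" and imp: "r \<le> 1 \<Longrightarrow> translation_defect_le m r d \<and> d \<le> C * r powr s" for m r d
  proof (cases "r \<le> 1")
    case True
    then show ?thesis using imp unfolding translation_defect_le_def by (meson add_left_mono order_trans)
  next
    case False
    then have "C * r powr s \<ge> 2 * 1" using C s by (intro mult_mono ge_one_powr_ge_zero) auto
    moreover have "measure m A \<le> 1" for A
      using m by (simp add: self_coupling_def prob_space.prob_le_1)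
    ultimately show ?thesis unfolding translation_defect_le_def
      by (smt (verit) measure_nonneg)
  qed
  have le: "r \<le> r powr s" if "0 < r" "r \<le> 1" for r :: real
    using powr_mono'[of s 1 r] that s by simp
  have "translation_defect_le (two_point_law N M p0 n) r (C * r powr s)" if "r > 0" for n r
    using that
  proof (induction n arbitrary: r)
    case 0
    have "2 * r \<le> C * r powr s" if "r \<le> 1"
      using C le[OF 0 that] 0 by (intro mult_mono) auto
    then show ?case
      using uniform_square_translation_defect[of r]
      by (intro small[where d = "2 * r"]) (auto simp: self_coupling_uniform_square 0)
  next
    case (Suc n)
    let ?d = "p0 * (C * (r / real N) powr s) + (1 - p0) * (C * (real M * r) powr s) + 2 * r"
    have coupling: "self_coupling (two_point_law N M p0 k)" for k
      using self_coupling_two_point_law NM p by blast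
    have "translation_defect_le (two_point_law N M p0 (Suc n)) r ?d"
      unfolding two_point_law_Suc
      using Suc NM by (intro translation_defect_annealed_push coupling p) auto
    moreover have "?d \<le> C * r powr s" if "r \<le> 1"
    proof -
      have "?d = C * q * r powr s + 2 * r"
        using Suc.prems NM by (simp add: q_def powr_mult powr_divide powr_minus field_simps)
      also have "\<dots> \<le> (C * q + 2) * r powr s"
        using le[OF Suc.prems that] by (simp add: distrib_right)
      finally show ?thesis by (simp add: C)
    qed
    ultimately show ?case by (intro small[OF coupling Suc.prems]) auto
  qed
  then show ?thesis by blast
qed

lemma two_point_law_uniformly_absolutely_continuous:
  assumes NM: "N > 0" "M > 0" and p: "0 \<le> p0" "p0 \<le> 1" and s: "s > 0"
    and C: "\<And>n r. r > 0 \<Longrightarrow> translation_defect_le (two_point_law N M p0 n) r (C * r powr s)"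
    and e: "e > 0"
  shows "\<exists>d>0. \<forall>n. \<forall>A\<in>sets borel. measure uniform_square A < d \<longrightarrow> measure (two_point_law N M p0 n) A < e"
proof -
  define r where "r = (e / (2 * (\<bar>C\<bar> + 1))) powr (1 / s)"
  have "r powr s = e / (2 * (\<bar>C\<bar> + 1))"
    using e s by (simp add: r_def powr_powr add_nonneg_pos)
  moreover have "C * (e / (2 * (\<bar>C\<bar> + 1))) < e / 2"
  proof -
    have "C * e < (\<bar>C\<bar> + 1) * e" using e by (intro mult_strict_right_mono) auto
    then show ?thesis by (simp add: field_simps add_nonneg_pos)
  qed
  moreover have "r > 0" using e by (simp add: r_def add_nonneg_pos)
  ultimately have r: "r > 0" "C * r powr s < e / 2" by simp_all
  have "measure (two_point_law N M p0 n) A < e"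
    if A: "A \<in> sets borel" and small: "measure uniform_square A < e / 2 * r\<^sup>2" for n A
  proof -
    have m: "self_coupling (two_point_law N M p0 n)" by (intro self_coupling_two_point_law NM p)
    have B: "A \<inter> unit_square \<in> sets borel" using A sets_unit_square by auto
    have eq: "emeasure uniform_square A = emeasure lborel (A \<inter> unit_square)"
      using A by (rule emeasure_uniform_square)
    have "emeasure uniform_square A < \<infinity>"
      using prob_space.emeasure_le_1[OF prob_space_uniform_square, of A] by (simp add: le_less_trans)
    then have "measure (two_point_law N M p0 n) (A \<inter> unit_square)
      \<le> measure lborel (A \<inter> unit_square) / r\<^sup>2 + C * r powr s"
      using m C[OF r(1), of n] B r by (intro measure_le_lborel_of_translation_defect)
        (auto simp: self_coupling_def eq)
    also have "measure lborel (A \<inter> unit_square) = measure uniform_square A"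
      by (simp add: measure_def eq)
    also have "\<dots> / r\<^sup>2 < e / 2" using small r by (simp add: field_simps)
    finally show ?thesis using self_coupling_Int_unit_square[OF m A] r(2) by simp
  qed
  then show ?thesis using e r(1) by (intro exI[of _ "e / 2 * r\<^sup>2"]) auto
qed

lemma two_point_law_Times_commute:
  assumes "N > 0" "M > 0" "0 \<le> p0" "p0 \<le> 1" "A \<in> sets borel" "B \<in> sets borel"
  shows "measure (two_point_law N M p0 n) (A \<times> B) = measure (two_point_law N M p0 n) (B \<times> A)"
  using assms(5,6)
proof (induction n arbitrary: A B)
  case 0
  then show ?case by (simp add: measure_uniform_square_Times)
next
  case (Suc n)
  then have "measure (two_point_law N M p0 n) (two_point_map N M i -` (A \<times> B)) =
    measure (two_point_law N M p0 n) (two_point_map N M i -` (B \<times> A))" for i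
    by (simp add: two_point_map_vimage_Times vimage_one_point_map_in_borel)
  then show ?case using assms(1-4) Suc.prems
    by (simp add: measure_two_point_law_Suc borel_Times del: two_point_law_Suc)
qed

text \<open>The variance of \<open>u\<close> is nonnegative.\<close>

lemma weighted_mean_square_le:
  fixes w u :: "'i \<Rightarrow> real"
  assumes w: "\<And>i. i \<in> I \<Longrightarrow> w i \<ge> 0" "(\<Sum>i\<in>I. w i) = 1"
  shows "(\<Sum>i\<in>I. w i * u i)\<^sup>2 \<le> (\<Sum>i\<in>I. w i * (u i)\<^sup>2)"
proof -
  have "(\<Sum>i\<in>I. w i * (u i - m)\<^sup>2) = (\<Sum>i\<in>I. w i * (u i)\<^sup>2) - 2 * m * (\<Sum>i\<in>I. w i * u i) + m\<^sup>2 * (\<Sum>i\<in>I. w i)" for m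
    by (simp add: power2_diff algebra_simps sum.distrib sum_subtractf sum_distrib_left sum_distrib_right)
  from this[of "\<Sum>i\<in>I. w i * u i"]
  have "(\<Sum>i\<in>I. w i * (u i - (\<Sum>i\<in>I. w i * u i))\<^sup>2) = (\<Sum>i\<in>I. w i * (u i)\<^sup>2) - (\<Sum>i\<in>I. w i * u i)\<^sup>2"
    by (simp add: w power2_eq_square)
  moreover have "0 \<le> (\<Sum>i\<in>I. w i * (u i - (\<Sum>i\<in>I. w i * u i))\<^sup>2)"
    using w(1) by (intro sum_nonneg) simp
  ultimately show ?thesis by simp
qed

text \<open>The expression is the integral of \<open>\<phi>(x) \<phi>(y)\<close> with \<open>\<phi> = 1\<^sub>A + c 1\<^sub>B\<close>. At \<open>n = 0\<close> it is the square of the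
  integral of \<open>\<phi>\<close>, which is the mean over \<open>i\<close> of the integrals of \<open>\<phi> \<circ> f\<^sub>i\<close>, whereas at \<open>n = 1\<close> it is the mean of
  their squares. The inequality then propagates, because passing from \<open>n\<close> to \<open>n + 1\<close> replaces \<open>\<phi>\<close> by \<open>\<phi> \<circ> f\<^sub>i\<close> and
  averages over \<open>i\<close>.\<close>

lemma two_point_law_quadratic_form_mono:
  assumes NM: "N > 0" "M > 0" and p: "0 \<le> p0" "p0 \<le> 1" and AB: "A \<in> sets borel" "B \<in> sets borel"
  defines "q \<equiv> \<lambda>n A B. measure (two_point_law N M p0 n) (A \<times> B)"
  shows "q n A A + c * q n A B + c * q n B A + c\<^sup>2 * q n B B
    \<le> q (Suc n) A A + c * q (Suc n) A B + c * q (Suc n) B A + c\<^sup>2 * q (Suc n) B B"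
  using AB
proof (induction n arbitrary: A B)
  note b = vimage_one_point_map_in_borel
  have step: "q (Suc n) A A + c * q (Suc n) A B + c * q (Suc n) B A + c\<^sup>2 * q (Suc n) B B
    = (\<Sum>i = 0..M. map_prob M p0 i * (let A' = one_point_map N M i -` A; B' = one_point_map N M i -` B in
        q n A' A' + c * q n A' B' + c * q n B' A' + c\<^sup>2 * q n B' B'))"
    if "A \<in> sets borel" "B \<in> sets borel" for n A B
    using that NM p unfolding q_def
    by (simp add: measure_two_point_law_Suc borel_Times two_point_map_vimage_Times Let_def
        sum.distrib sum_distrib_left algebra_simps del: two_point_law_Suc)
  {
    case 0
    let ?u = "\<lambda>i. measure uniform_interval (one_point_map N M i -` A) + c * measure uniform_interval (one_point_map N M i -` B)"
    have sq: "q 0 A A + c * q 0 A B + c * q 0 B A + c\<^sup>2 * q 0 B B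
        = (measure uniform_interval A + c * measure uniform_interval B)\<^sup>2"
      if "A \<in> sets borel" "B \<in> sets borel" for A B
      using that by (simp add: q_def measure_uniform_square_Times power2_eq_square algebra_simps)
    have mean: "(\<Sum>i = 0..M. map_prob M p0 i * ?u i) = measure uniform_interval A + c * measure uniform_interval B"
      using uniform_interval_stationary[OF NM 0(1), of p0] uniform_interval_stationary[OF NM 0(2), of p0]
      by (simp add: distrib_left sum.distrib mult.left_commute[of _ c] flip: sum_distrib_left)
    have "(\<Sum>i = 0..M. map_prob M p0 i * ?u i)\<^sup>2 \<le> (\<Sum>i = 0..M. map_prob M p0 i * (?u i)\<^sup>2)"
      using map_prob_nonneg[OF p] sum_map_prob_eq_1[OF NM(2)] by (intro weighted_mean_square_le) auto
    then show ?case
      unfolding step[OF 0] Let_def using 0 by (simp add: sq b mean)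
  next
    case (Suc n)
    show ?case
      unfolding step[OF Suc.prems] Let_def
      by (intro sum_mono mult_left_mono Suc.IH b Suc.prems map_prob_nonneg p)
  }
qed

text \<open>Polarization: the forms with \<open>A = B\<close> and with \<open>c = 1\<close> are bounded and increasing, and they determine the
  mixed term.\<close>

lemma two_point_law_Times_convergent:
  assumes NM: "N > 0" "M > 0" and p: "0 \<le> p0" "p0 \<le> 1" and AB: "A \<in> sets borel" "B \<in> sets borel"
  shows "convergent (\<lambda>n. measure (two_point_law N M p0 n) (A \<times> B))"
proof -
  define q where "q n A B = measure (two_point_law N M p0 n) (A \<times> B)" for n A B
  note mono = two_point_law_quadratic_form_mono[OF NM p, folded q_def]
  have bound: "0 \<le> q n A B" "q n A B \<le> 1" for n A B
    using self_coupling_two_point_law[OF NM p, of n]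
    by (auto simp: q_def self_coupling_def prob_space.prob_le_1)
  have comm: "q n B A = q n A B" for n
    unfolding q_def using NM p AB by (intro two_point_law_Times_commute)
  have diag: "convergent (\<lambda>n. q n A A)" if "A \<in> sets borel" for A
  proof (rule Bseq_mono_convergent)
    show "Bseq (\<lambda>n. q n A A)" using bound by (intro BseqI'[of _ 1]) simp
    have "q m A A \<le> q n A A" if "m \<le> n" for m n
      using mono[OF \<open>A \<in> sets borel\<close> \<open>A \<in> sets borel\<close>, of _ 0]
      by (intro lift_Suc_mono_le[OF _ that, of "\<lambda>n. q n A A"]) simp
    then show "\<forall>m. \<forall>n\<ge>m. q m A A \<le> q n A A" by blast
  qed
  have form: "convergent (\<lambda>n. q n A A + 2 * q n A B + q n B B)"
  proof (rule Bseq_mono_convergent)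
    show "Bseq (\<lambda>n. q n A A + 2 * q n A B + q n B B)"
    proof (rule BseqI'[of _ 4])
      show "norm (q n A A + 2 * q n A B + q n B B) \<le> 4" for n
        using bound[of n A A] bound[of n A B] bound[of n B B] by simp
    qed
    have "q m A A + 2 * q m A B + q m B B \<le> q n A A + 2 * q n A B + q n B B" if "m \<le> n" for m n
      using mono[OF AB, of _ 1]
      by (intro lift_Suc_mono_le[OF _ that, of "\<lambda>n. q n A A + 2 * q n A B + q n B B"]) (simp add: comm algebra_simps)
    then show "\<forall>m. \<forall>n\<ge>m. q m A A + 2 * q m A B + q m B B \<le> q n A A + 2 * q n A B + q n B B" by blast
  qed
  have "convergent (\<lambda>n. 1 / 2 * (q n A A + 2 * q n A B + q n B B - q n A A - q n B B))"
    using form diag[OF AB(1)] diag[OF AB(2)]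
    by (intro convergent_mult convergent_diff convergent_const) auto
  then show ?thesis by (simp add: q_def)
qed

lemma two_point_law_limit:
  assumes NM: "N > 0" "M > 0" and p: "0 \<le> p0" "p0 \<le> 1" and s: "s > 0"
    and C: "\<And>n r. r > 0 \<Longrightarrow> translation_defect_le (two_point_law N M p0 n) r (C * r powr s)"
  shows "\<exists>m. prob_space m \<and> sets m = sets borel \<and>
    (\<forall>A\<in>sets borel. (\<lambda>n. measure (two_point_law N M p0 n) A) \<longlonglongrightarrow> measure m A)"
proof -
  let ?E = "{a \<times> b | a b. a \<in> sets (borel :: real measure) \<and> b \<in> sets (borel :: real measure)}"
  have space: "space uniform_square = UNIV"
    using space_self_coupling[OF self_coupling_uniform_square] .
  have gen: "sets uniform_square = sigma_sets (space uniform_square) ?E"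
  proof -
    have "sets uniform_square = sets (borel \<Otimes>\<^sub>M borel :: (real \<times> real) measure)"
      by (simp only: borel_prod sets_uniform)
    also have "\<dots> = sigma_sets (space uniform_square) ?E"
      unfolding sets_pair_measure by (simp add: space)
    finally show ?thesis .
  qed
  have laws: "prob_space (two_point_law N M p0 n)" "sets (two_point_law N M p0 n) = sets uniform_square" for n
    using self_coupling_two_point_law[OF NM p, of n] by (simp_all add: self_coupling_def)
  have "\<exists>m. prob_space m \<and> sets m = sets uniform_square \<and>
    (\<forall>A\<in>sets uniform_square. (\<lambda>n. measure (two_point_law N M p0 n) A) \<longlonglongrightarrow> measure m A)"
  proof (rule uniformly_absolutely_continuous_limit[OF _ laws _ gen Int_stable_pair_measure_generator])
    show "finite_measure uniform_square" using prob_space_uniform_square by (simp add: prob_space_def)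
    show "\<exists>d>0. \<forall>n. \<forall>A\<in>sets uniform_square. measure uniform_square A < d \<longrightarrow>
        measure (two_point_law N M p0 n) A < e" if "e > 0" for e
      using two_point_law_uniformly_absolutely_continuous[OF NM p s C that] by simp
    show "convergent (\<lambda>n. measure (two_point_law N M p0 n) A)" if "A \<in> ?E" for A
      using that two_point_law_Times_convergent[OF NM p] by blast
  qed (auto simp: space)
  then show ?thesis by simp
qed

section \<open>Positivity on open sets\<close>

definition multiply_mod_one :: "nat \<Rightarrow> real \<times> real \<Rightarrow> real \<times> real" where
  "multiply_mod_one k z = (frac (real k * fst z), frac (real k * snd z))"

lemma borel_measurable_multiply_mod_one: "multiply_mod_one k \<in> borel_measurable borel"
  unfolding multiply_mod_one_def frac_def borel_prod[symmetric] by measurable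

lemma frac_mult_frac: "frac (real k * frac x) = frac (real k * x)"
proof -
  have "real k * x - frac (real k * frac x) = of_int (int k * \<lfloor>x\<rfloor> + \<lfloor>real k * frac x\<rfloor>)"
    by (simp add: frac_def algebra_simps)
  then show ?thesis
    by (intro sym[OF iffD2[OF frac_unique_iff]]) (auto simp: frac_lt_1)
qed

text \<open>The \<open>q\<close> translates of an interval of length \<open>1 / q\<close> by multiples of \<open>1 / q\<close> tile the circle.\<close>

lemma frac_translation_hits_interval:
  fixes x a :: real
  assumes q: "q > 0" and a: "0 \<le> a" "a + 1 / real q \<le> 1"
  shows "\<exists>i<q. frac (x - real i / real q) \<in> {a..<a + 1 / real q}"
proof -
  define i where "i = nat \<lfloor>real q * frac (x - a)\<rfloor>"
  have i: "real i \<le> real q * frac (x - a)" "real q * frac (x - a) < real i + 1"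
    by (simp_all add: i_def)
  have "real q * frac (x - a) < real q * 1"
    using q by (intro mult_strict_left_mono frac_lt_1) auto
  then have "i < q" using i by linarith
  define y where "y = frac (x - a) - real i / real q"
  have "frac (x - a) < (real i + 1) / real q" "real i / real q \<le> frac (x - a)"
    using i q by (simp_all add: pos_less_divide_eq pos_divide_le_eq mult.commute)
  then have y: "0 \<le> y" "y < 1 / real q" by (auto simp: y_def add_divide_distrib)
  have "x - real i / real q - (a + y) = of_int \<lfloor>x - a\<rfloor>"
    by (simp add: y_def frac_def)
  then have "frac (x - real i / real q) = a + y"
    using y a by (auto simp: frac_unique_iff)
  then show ?thesis using \<open>i < q\<close> y by auto
qed

lemma openin_unit_square_contains_box:
  assumes "openin (top_of_set unit_square) U" "U \<noteq> {}"
  obtains a b q where "q > 0" "0 \<le> a" "a + 1 / real q \<le> 1" "0 \<le> b" "b + 1 / real q \<le> 1"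
    "{a..<a + 1 / real q} \<times> {b..<b + 1 / real q} \<subseteq> U"
proof -
  obtain T where T: "open T" "U = unit_square \<inter> T" using assms(1) by (auto simp: openin_open)
  obtain a b where ab: "(a, b) \<in> U" using assms(2) by auto
  then have sq: "a \<in> {0..<1}" "b \<in> {0..<1}" using T by (auto simp: mem_unit_square)
  have "(a, b) \<in> T" using ab T(2) by simp
  then obtain V W where "open V" "open W" "(a, b) \<in> V \<times> W" "V \<times> W \<subseteq> T"
    by (rule open_prod_elim[OF T(1)])
  then have VW: "open V" "open W" "a \<in> V" "b \<in> W" "V \<times> W \<subseteq> T" by auto
  obtain v w where v: "v > 0" "ball a v \<subseteq> V" and w: "w > 0" "ball b w \<subseteq> W"
    using VW by (meson open_contains_ball)
  define e where "e = Min {v, w, 1 - a, 1 - b}"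
  have "e > 0" using v w sq by (simp add: e_def)
  then obtain q where q: "q > 0" "1 / real q < e"
    by (metis nat_approx_posE of_nat_0_less_iff of_nat_Suc zero_less_Suc)
  have le: "e \<le> v" "e \<le> w" "e \<le> 1 - a" "e \<le> 1 - b" by (auto simp: e_def)
  have "(x, y) \<in> U" if x: "x \<in> {a..<a + 1 / real q}" and y: "y \<in> {b..<b + 1 / real q}" for x y
  proof -
    have "x \<in> ball a v" "y \<in> ball b w" using x y q le by (auto simp: dist_real_def)
    then have "(x, y) \<in> T" using v(2) w(2) VW(5) by blast
    moreover have "x \<in> {0..<1}" "y \<in> {0..<1}"
      using x y q le sq unfolding atLeastLessThan_iff by linarith+
    ultimately show ?thesis using T(2) by (simp add: unit_square_def)
  qed
  then show ?thesis using q le sq by (intro that[of q a b]) auto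
qed

text \<open>Iterating \<open>p\<^sub>0 m (f\<^sub>0\<^sup>-\<^sup>1 A) \<le> m A\<close>. The \<open>n\<close>-th iterate of \<open>f\<^sub>0\<close> is multiplication by \<open>N\<^sup>n\<close> mod \<open>1\<close>; for \<open>n = 0\<close> that
  multiplication is the identity only on the square, which carries all the mass.\<close>

lemma stationary_expand_lower_bound:
  assumes m: "finite_measure m" "sets m = sets borel"
    and null: "\<And>A. A \<in> sets borel \<Longrightarrow> measure m (A \<inter> unit_square) = measure m A"
    and inv: "\<And>A. A \<in> sets borel \<Longrightarrow> p0 * measure m (two_point_map N M 0 -` A) \<le> measure m A"
    and p: "p0 \<ge> 0" and A: "A \<in> sets borel"
  shows "p0 ^ n * measure m (multiply_mod_one (N ^ n) -` A) \<le> measure m A"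
proof -
  define F where "F n = multiply_mod_one (N ^ n) -` A" for n
  have F_borel: "F n \<in> sets borel" for n
    using measurable_sets_borel[OF borel_measurable_multiply_mod_one A] by (simp add: F_def)
  have F_Suc: "two_point_map N M 0 -` F n = F (Suc n)" for n
  proof -
    have "frac (real (N ^ n) * frac (real N * x)) = frac (real (N ^ Suc n) * x)" for x
      by (subst frac_mult_frac) (simp add: mult.assoc mult.left_commute)
    then show ?thesis by (simp add: F_def multiply_mod_one_def two_point_map_def one_point_map_def vimage_def)
  qed
  have "p0 ^ n * measure m (F n) \<le> measure m A"
  proof (induction n)
    case 0
    have "F 0 \<inter> unit_square = A \<inter> unit_square"
      by (auto simp: F_def multiply_mod_one_def unit_square_def frac_eq[THEN iffD2])
    then show ?case using null[OF F_borel, of 0] null[OF A] by simp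
  next
    case (Suc n)
    have "p0 ^ Suc n * measure m (F (Suc n)) = p0 ^ n * (p0 * measure m (two_point_map N M 0 -` F n))"
      by (simp add: F_Suc)
    also have "\<dots> \<le> p0 ^ n * measure m (F n)"
      using inv[OF F_borel] p by (intro mult_left_mono) auto
    finally show ?case using Suc by simp
  qed
  then show ?thesis by (simp add: F_def)
qed

text \<open>The preimage \<open>B\<close> of the box is periodic with period \<open>r = N\<^sup>-\<^sup>n\<close>, and \<open>q\<^sup>2\<close> of its translates by less than one
  period cover the plane. Each of them has mass at most \<open>m B + C r\<^sup>s\<close>, so \<open>1 \<le> q\<^sup>2 (m B + C r\<^sup>s)\<close>.\<close>

lemma translation_regular_box_positive:
  assumes m: "prob_space m" "sets m = sets borel"
    and C: "\<And>r. r > 0 \<Longrightarrow> translation_defect_le m r (C * r powr s)" and s: "s > 0"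
    and N: "N \<ge> 2" and q: "q > 0"
    and a: "0 \<le> a" "a + 1 / real q \<le> 1" and b: "0 \<le> b" "b + 1 / real q \<le> 1"
  shows "\<exists>n. measure m (multiply_mod_one (N ^ n) -`
    ({a..<a + 1 / real q} \<times> {b..<b + 1 / real q})) > 0"
proof -
  interpret prob_space m by (rule m)
  have space: "space m = UNIV" using sets_eq_imp_space_eq[OF m(2)] by simp
  let ?V = "{a..<a + 1 / real q} \<times> {b..<b + 1 / real q}"
  have "C * 1 powr s \<ge> 0"
    using translation_defect_leD[OF C[of 1], of "{}" 0] by simp
  then have C0: "C \<ge> 0" by simp
  have "real N powr (- s) < 1" using N s by (simp add: powr_less_one)
  then obtain n where n: "(real N powr (- s)) ^ n < 1 / ((C + 1) * real q ^ 2)"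
    using real_arch_pow_inv[of "1 / ((C + 1) * real q ^ 2)" "real N powr (- s)"] C0 q by auto
  define r where "r = 1 / real (N ^ n)"
  have r: "r > 0" using N by (simp add: r_def)
  have "r powr s = (real N powr (- s)) ^ n"
    using N by (simp add: r_def powr_divide powr_minus_divide powr_power powr_powr power_one_over
        mult.commute flip: powr_realpow)
  then have "(C + 1) * real q ^ 2 * r powr s < 1"
    using n C0 q by (simp add: pos_less_divide_eq mult.commute)
  moreover have "real q ^ 2 * r powr s > 0" using q r by simp
  ultimately have small: "real q ^ 2 * (C * r powr s) < 1" by (simp add: algebra_simps)
  define B where "B = multiply_mod_one (N ^ n) -` ?V"
  have V: "?V \<in> sets borel" by (intro borel_Times) auto
  have B: "B \<in> sets borel"
    using measurable_sets_borel[OF borel_measurable_multiply_mod_one V] by (simp only: B_def)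
  \<comment> \<open>Translation of the periodic set by multiples of \<open>r / q\<close>, where \<open>r = 1 / N^n\<close> is its period: the
    \<open>q \<times> q\<close> translates cover the plane.\<close>
  define t where "t i j = (- (real i / real q) * r, - (real j / real q) * r)" for i j :: nat
  let ?T = "\<lambda>(i, j). (\<lambda>z. z + t i j) -` B"
  have cover: "UNIV \<subseteq> (\<Union>ij\<in>{..<q} \<times> {..<q}. ?T ij)"
  proof
    fix z :: "real \<times> real"
    obtain i j where ij: "i < q" "frac (real (N ^ n) * fst z - real i / real q) \<in> {a..<a + 1 / real q}"
      "j < q" "frac (real (N ^ n) * snd z - real j / real q) \<in> {b..<b + 1 / real q}"
      using frac_translation_hits_interval[OF q a] frac_translation_hits_interval[OF q b] by meson
    have "real (N ^ n) * (x - real k / real q * r) = real (N ^ n) * x - real k / real q" for x and k :: nat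
      using N by (simp add: r_def right_diff_distrib)
    then have "z + t i j \<in> B" using ij by (simp add: B_def multiply_mod_one_def t_def)
    then show "z \<in> (\<Union>ij\<in>{..<q} \<times> {..<q}. ?T ij)" using ij by auto
  qed
  have T: "(\<lambda>z. z + t i j) -` B \<in> sets borel" for i j
    by (rule vimage_translation_in_borel[OF B])
  have each: "measure m ((\<lambda>z. z + t i j) -` B) \<le> measure m B + C * r powr s" if "i < q" "j < q" for i j
  proof -
    have "\<bar>real k / real q * r\<bar> \<le> r" if "k < q" for k
      using mult_right_mono[of "real k / real q" 1 r] that r by simp
    then have "measure m ((\<lambda>z. z + t i j) -` B)
      \<le> measure m ((\<lambda>z. z + (- t i j)) -` ((\<lambda>z. z + t i j) -` B)) + C * r powr s"
      using that by (intro translation_defect_leD[OF C[OF r] T]) (auto simp: t_def)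
    also have "(\<lambda>z. z + (- t i j)) -` ((\<lambda>z. z + t i j) -` B) = B" by (simp add: vimage_def)
    finally show ?thesis .
  qed
  have "1 = measure m UNIV" using prob_space by (simp add: space)
  also have "\<dots> \<le> measure m (\<Union>ij\<in>{..<q} \<times> {..<q}. ?T ij)"
    using cover T by (intro finite_measure_mono) (auto simp: m(2))
  also have "\<dots> \<le> (\<Sum>ij\<in>{..<q} \<times> {..<q}. measure m (?T ij))"
    using T by (intro measure_UNION_le) (auto simp: m(2))
  also have "\<dots> \<le> (\<Sum>ij\<in>{..<q} \<times> {..<q}. measure m B + C * r powr s)"
    using each by (intro sum_mono) auto
  also have "\<dots> = real q ^ 2 * measure m B + real q ^ 2 * (C * r powr s)"
    by (simp add: power2_eq_square distrib_left)
  finally have "real q ^ 2 * measure m B > 0" using small by linarith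
  then have "measure m B > 0" by (simp add: zero_less_mult_iff)
  then show ?thesis by (auto simp: B_def)
qed

theorem theorem3p13:
  fixes M N :: nat and p0 :: real
  assumes "M \<ge> 2" and "N \<ge> 2"
    and "0 < p0" and "p0 < 1"
    and "lyapunov_exponent N M p0 > 0"
  shows "\<exists>m :: (real \<times> real) measure.
           sets m = sets lebesgue_square \<and> prob_space m \<and>
           stationary N M p0 m \<and>
           absolutely_continuous lebesgue_square m \<and>
           full_support m"
proof -
  have NM: "N > 0" "M > 0" and p: "0 \<le> p0" "p0 \<le> 1" using assms by auto
  let ?law = "two_point_law N M p0"
  obtain s where s: "0 < s" "s \<le> 1" "p0 * real N powr (- s) + (1 - p0) * real M powr s < 1"
    using exists_contracting_exponent[OF NM assms(5)] by blast
  obtain C where C: "\<And>n r. r > 0 \<Longrightarrow> translation_defect_le (?law n) r (C * r powr s)"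
    using two_point_law_translation_defect[OF NM p s] by blast
  obtain m where m: "prob_space m" "sets m = sets borel"
    and lim: "\<And>A. A \<in> sets borel \<Longrightarrow> (\<lambda>n. measure (?law n) A) \<longlonglongrightarrow> measure m A"
    using two_point_law_limit[OF NM p s(1) C] by blast
  interpret prob_space m by (rule m)
  have stat: "measure m A = (\<Sum>i = 0..M. map_prob M p0 i * measure m (two_point_map N M i -` A))"
    if A: "A \<in> sets borel" for A
  proof (rule LIMSEQ_unique)
    show "(\<lambda>n. measure (?law (Suc n)) A) \<longlonglongrightarrow> measure m A"
      using lim[OF A] by (rule LIMSEQ_Suc)
    show "(\<lambda>n. measure (?law (Suc n)) A) \<longlonglongrightarrow>
        (\<Sum>i = 0..M. map_prob M p0 i * measure m (two_point_map N M i -` A))"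
      unfolding measure_two_point_law_Suc[OF NM p A]
      by (intro tendsto_sum tendsto_mult tendsto_const lim vimage_two_point_map_in_borel A)
  qed
  have null: "measure m (A \<inter> unit_square) = measure m A" if A: "A \<in> sets borel" for A
  proof (rule LIMSEQ_unique)
    have "A \<inter> unit_square \<in> sets borel" using A sets_unit_square by auto
    then show "(\<lambda>n. measure (?law n) (A \<inter> unit_square)) \<longlonglongrightarrow> measure m (A \<inter> unit_square)" by (rule lim)
    show "(\<lambda>n. measure (?law n) (A \<inter> unit_square)) \<longlonglongrightarrow> measure m A"
      using lim[OF A] self_coupling_Int_unit_square[OF self_coupling_two_point_law[OF NM p] A] by simp
  qed
  have defect: "translation_defect_le m r (C * r powr s)" if "r > 0" for r
    unfolding translation_defect_le_def
  proof (intro ballI allI impI)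
    fix A :: "(real \<times> real) set" and t :: "real \<times> real"
    assume "A \<in> sets borel" "\<bar>fst t\<bar> \<le> r" "\<bar>snd t\<bar> \<le> r"
    then show "measure m A \<le> measure m ((\<lambda>z. z + t) -` A) + C * r powr s"
      using translation_defect_leD[OF C[OF \<open>r > 0\<close>]]
      by (intro LIMSEQ_le[OF lim tendsto_add[OF lim tendsto_const]] vimage_translation_in_borel) auto
  qed
  have ac: "measure m A = 0" if A: "A \<in> sets borel" and "measure uniform_square A = 0" for A
  proof (rule antisym[OF field_le_epsilon])
    fix e :: real assume "e > 0"
    then have "measure (?law n) A < e" for n
      using two_point_law_uniformly_absolutely_continuous[OF NM p s(1) C] that by metis
    then show "measure m A \<le> 0 + e"
      by (intro LIMSEQ_le_const2[OF lim[OF A]]) (auto intro: less_imp_le)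
  qed simp
  \<comment> \<open>So far \<open>m\<close> is a measure on the plane; the measure sought lives on the square.\<close>
  define m' where "m' = restrict_space m unit_square"
  have sq: "unit_square \<in> sets m" using sets_unit_square by (simp add: m)
  have sets': "sets m' = sets lebesgue_square"
    unfolding m'_def lebesgue_square_def by (intro sets_restrict_space_cong) (simp add: m)
  have space': "space m' = unit_square"
    using sets_eq_imp_space_eq[OF m(2)] by (simp add: m'_def space_restrict_space)
  have in_sets': "A \<in> sets borel \<and> A \<subseteq> unit_square" if "A \<in> sets m'" for A
    using that sq by (auto simp: m'_def sets_restrict_space_iff m)
  have em': "emeasure m' A = ennreal (measure m A)" if "A \<in> sets borel" "A \<subseteq> unit_square" for A
    using that sq by (simp add: m'_def emeasure_restrict_space emeasure_eq_measure)
  have "prob_space m'"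
  proof (rule prob_spaceI)
    have "measure m unit_square = 1"
      using null[of UNIV] prob_space sets_eq_imp_space_eq[OF m(2)] by simp
    then show "emeasure m' (space m') = 1" using em'[OF sets_unit_square] by (simp add: space')
  qed
  moreover have "stationary N M p0 m'"
    unfolding stationary_def
  proof
    fix A assume A': "A \<in> sets m'"
    then have A: "A \<in> sets borel" "A \<subseteq> unit_square" using in_sets' by auto
    have push: "emeasure (distr m' m' (two_point_map N M i)) A = ennreal (measure m (two_point_map N M i -` A))"
      if "i \<le> M" for i
    proof -
      have "two_point_map N M i \<in> measurable m' m'"
        using measurable_two_point_map[OF that] by (simp add: measurable_cong_sets[OF sets' sets'])
      then have "emeasure (distr m' m' (two_point_map N M i)) A = emeasure m' (two_point_map N M i -` A \<inter> unit_square)"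
        using A' by (simp add: emeasure_distr space')
      also have "\<dots> = ennreal (measure m (two_point_map N M i -` A))"
        using vimage_two_point_map_in_borel[OF A(1)] sets_unit_square by (subst em') (auto simp: null)
      finally show ?thesis .
    qed
    have "emeasure m' A = ennreal (\<Sum>i = 0..M. map_prob M p0 i * measure m (two_point_map N M i -` A))"
      using em'[OF A] stat[OF A(1)] by simp
    also have "\<dots> = (\<Sum>i = 0..M. ennreal (map_prob M p0 i) * ennreal (measure m (two_point_map N M i -` A)))"
      using map_prob_nonneg[OF p] by (simp add: ennreal_mult flip: sum_ennreal)
    also have "\<dots> = (\<Sum>i = 0..M. ennreal (map_prob M p0 i) * emeasure (distr m' m' (two_point_map N M i)) A)"
      by (intro sum.cong) (auto simp: push)
    finally show "emeasure m' A =
      (\<Sum>i = 0..M. ennreal (map_prob M p0 i) * emeasure (distr m' m' (two_point_map N M i)) A)" .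
  qed
  moreover have "absolutely_continuous lebesgue_square m'"
    unfolding absolutely_continuous_def
  proof
    fix A assume A': "A \<in> null_sets lebesgue_square"
    then have A: "A \<in> sets borel" "A \<subseteq> unit_square" using in_sets' sets' by auto
    have "emeasure lborel A = 0"
      using A' A sets_unit_square
      by (auto simp: null_sets_def lebesgue_square_def emeasure_restrict_space)
    then have "measure uniform_square A = 0"
      using A by (simp add: measure_def emeasure_uniform_square Int_absorb2)
    then show "A \<in> null_sets m'"
      using ac[OF A(1)] em'[OF A] A' sets' by (auto simp: null_sets_def)
  qed
  moreover have "full_support m'"
    unfolding full_support_def
  proof (intro allI impI)
    fix U assume U: "openin (top_of_set unit_square) U \<and> U \<noteq> {}"
    obtain a b q where q: "q > 0" and a: "0 \<le> a" "a + 1 / real q \<le> 1" and b: "0 \<le> b" "b + 1 / real q \<le> 1"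
      and sub: "{a..<a + 1 / real q} \<times> {b..<b + 1 / real q} \<subseteq> U" (is "?V \<subseteq> U")
      using openin_unit_square_contains_box U by metis
    have V: "?V \<in> sets borel" by (intro borel_Times) auto
    obtain n where n: "measure m (multiply_mod_one (N ^ n) -` ?V) > 0"
      using translation_regular_box_positive[OF m defect s(1) assms(2) q a b] by blast
    have inv: "p0 * measure m (two_point_map N M 0 -` A) \<le> measure m A" if "A \<in> sets borel" for A
      unfolding stat[OF that] using p
      by (simp add: sum_map_prob[OF NM(2)] sum_nonneg)
    have "0 < p0 ^ n * measure m (multiply_mod_one (N ^ n) -` ?V)"
      using n assms(3) by simp
    also have "\<dots> \<le> measure m ?V"
      by (rule stationary_expand_lower_bound[OF finite_measure_axioms m(2) null inv p(1) V])
    finally have "measure m ?V > 0" .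
    obtain T where T: "open T" "U = unit_square \<inter> T" using U by (auto simp: openin_open)
    then have U': "U \<in> sets borel" "U \<subseteq> unit_square" using sets_unit_square by auto
    then have "measure m ?V \<le> measure m U" using sub by (intro finite_measure_mono) (auto simp: m)
    then show "0 < emeasure m' U" using \<open>measure m ?V > 0\<close> em'[OF U'] by simp
  qed
  ultimately show ?thesis using sets' by blast
qed

end
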